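(* Consider the adapt-then-combine diffusion strategy over a weakly-connected network as described in the context, with step-sizes $\mu_k=\tau_k\mu_{\max}$ ($0<\tau_k\le 1$ fixed). Assume each $J_k$ is convex (and twice differentiable with uniformly bounded Hessian), that in each sub-network $s$ of group $S$ at least one cost $J_{s,k}$ is strongly convex, and that the gradient noise satisfies the first- and second-order moment conditions stated in the context. Then, for sufficiently small step-sizes, the network is mean-square stable: for every agent $k$, $$\limsup_{i\to\infty}\mathbb{E}\|w_k^\star-\boldsymbol{w}_{k,i}\|^2=O(\mu_{\max}),$$ where $w_k^\star$ is the limit point of agent $k$ defined in the context.
   Context: Network: $N$ agents partitioned into sub-networks $1,\dots,S+R$; agents of sub-networks $1,\dots,S$ (group $S$, $N_{gS}$ agents) numbered first, then those of $S+1,\dots,S+R$ (group $R$). Combination matrix $A=[a_{\ell k}]$ nonnegative, left-stochastic, $a_{\ell k}=0$ unless $\ell\in\mathcal{N}_k$ (neighborhood of $k$, containing $k$), of block form $A=\begin{bmatrix}T_{SS}&T_{SR}\\0&T_{RR}\end{bmatrix}$ with $T_{SS}=\mathrm{blockdiag}\{A_1,\dots,A_S\}$, each $A_s\in\mathbb{R}^{N_s\times N_s}$ left-stochastic primitive with Perron vector $p_s$ ($A_sp_s=p_s$, $\mathbb{1}^{\mathsf T}p_s=1$, $p_s\succ 0$), and $T_{RR}$ block upper triangular with diagonal blocks $A_r$ ($r=S+1,\dots,S+R$), each the nonnegative irreducible matrix of internal weights of a connected sub-network that receives information from outside it (some column of $A_r$ sums to less than one). Let $W=T_{SR}(I-T_{RR})^{-1}$.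 Algorithm: agent $k$ has cost $J_k:\mathbb{R}^M\to\mathbb{R}$ and runs $\boldsymbol{\psi}_{k,i}=\boldsymbol{w}_{k,i-1}-\mu_k\widehat{\nabla_{w^{\mathsf T}}J_k}(\boldsymbol{w}_{k,i-1})$, $\boldsymbol{w}_{k,i}=\sum_{\ell\in\mathcal{N}_k}a_{\ell k}\boldsymbol{\psi}_{\ell,i}$, where the stochastic gradient approximation defines the gradient noise $\boldsymbol{s}_{k,i}(\boldsymbol{w}_{k,i-1})=\widehat{\nabla_{w^{\mathsf T}}J_k}(\boldsymbol{w}_{k,i-1})-\nabla_{w^{\mathsf T}}J_k(\boldsymbol{w}_{k,i-1})$; $\mathcal{F}_{i-1}$ is the filtration generated by $\{\boldsymbol{w}_{\ell,j}: j\le i-1,\ \ell=1,\dots,N\}$. Limit points: for agent $k$ in sub-network $s\le S$ with agents' step-sizes $\mu_{s,k}$ and costs $J_{s,k}$, set $q_{s,k}=\mu_{s,k}p_{s,k}$ and let $w_s^\star$ be the unique solution of $\sum_{k=1}^{N_s}q_{s,k}\nabla_{w^{\mathsf T}}J_{s,k}(w_s^\star)=0$; $w_k^\star=w_s^\star$ for such agents. With $\omega^\star=\mathrm{col}\{\mathbb{1}_{N_1}\otimes w_1^\star,\dots,\mathbb{1}_{N_S}\otimes w_S^\star\}$, the limit points $w_k^\star$ of the group-$R$ agents (in agent order) are the $M$-blocks of $(W\otimes I_M)^{\mathsf T}\omega^\star$. Gradient noise conditions: for all $k,i$, $\mathbb{E}[\boldsymbol{s}_{k,i}(\boldsymbol{w}_{k,i-1})\mid\mathcal{F}_{i-1}]=0$,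 the noises of different agents are conditionally uncorrelated given $\mathcal{F}_{i-1}$, and $\mathbb{E}[\|\boldsymbol{s}_{k,i}(\boldsymbol{w}_{k,i-1})\|^2\mid\mathcal{F}_{i-1}]\le\beta_k^2\|w_k^\star-\boldsymbol{w}_{k,i-1}\|^2+\sigma_k^2$ for some constants $\beta_k^2,\sigma_k^2\ge 0$. "For sufficiently small step-sizes, $X=O(\mu_{\max})$" means there are $\bar\mu>0$ and $c$ independent of $\mu_{\max}$ with $X\le c\mu_{\max}$ for all $\mu_{\max}<\bar\mu$.
   Formalization: The initial iterates are assumed to have finite second moments; without this the claim fails (one agent, J(w)=w²/2, no noise, initial iterate of infinite variance). Square-integrability of the gradient noise, also assumed, then follows from the stated noise conditions. *)

theory Defs
  imports "HOL-Probability.Probability" "Jordan_Normal_Form.Gauss_Jordan_Elimination"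
begin

text \<open>Matrices over the agent index set are functions nat => nat => real
  (entry a l k = a_{l k}); submatrices are obtained by restricting to an index set.\<close>

fun sub_mat_pow :: "nat set \<Rightarrow> (nat \<Rightarrow> nat \<Rightarrow> real) \<Rightarrow> nat \<Rightarrow> nat \<Rightarrow> nat \<Rightarrow> real" where
  "sub_mat_pow I a 0 = (\<lambda>i j. if i = j then 1 else 0)"
| "sub_mat_pow I a (Suc m) = (\<lambda>i j. \<Sum>l\<in>I. sub_mat_pow I a m i l * a l j)"

definition irreducible_sub :: "nat set \<Rightarrow> (nat \<Rightarrow> nat \<Rightarrow> real) \<Rightarrow> bool" where
  "irreducible_sub I a \<longleftrightarrow> (\<forall>i\<in>I. \<forall>j\<in>I. a i j \<ge> 0) \<and>
     (\<forall>i\<in>I. \<forall>j\<in>I. \<exists>m. sub_mat_pow I a m i j > 0)"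

definition primitive_sub :: "nat set \<Rightarrow> (nat \<Rightarrow> nat \<Rightarrow> real) \<Rightarrow> bool" where
  "primitive_sub I a \<longleftrightarrow> (\<forall>i\<in>I. \<forall>j\<in>I. a i j \<ge> 0) \<and>
     (\<exists>m>0. \<forall>i\<in>I. \<forall>j\<in>I. sub_mat_pow I a m i j > 0)"

text \<open>Agents of sub-network s (sub-networks numbered 0 .. S+R-1; group S = those < S).\<close>
definition subnet :: "nat \<Rightarrow> (nat \<Rightarrow> nat) \<Rightarrow> nat \<Rightarrow> nat set" where
  "subnet N sn s = {k. k < N \<and> sn k = s}"

text \<open>W = T_SR (I - T_RR)^{-1}, where group S consists of the agents 0..<NgS and
  group R of the agents NgS..<N.\<close>
definition T_SR :: "nat \<Rightarrow> nat \<Rightarrow> (nat \<Rightarrow> nat \<Rightarrow> real) \<Rightarrow> real mat" where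
  "T_SR N NgS a = mat NgS (N - NgS) (\<lambda>(i, j). a i (NgS + j))"

definition T_RR :: "nat \<Rightarrow> nat \<Rightarrow> (nat \<Rightarrow> nat \<Rightarrow> real) \<Rightarrow> real mat" where
  "T_RR N NgS a = mat (N - NgS) (N - NgS) (\<lambda>(i, j). a (NgS + i) (NgS + j))"

definition W_mat :: "nat \<Rightarrow> nat \<Rightarrow> (nat \<Rightarrow> nat \<Rightarrow> real) \<Rightarrow> real mat" where
  "W_mat N NgS a = T_SR N NgS a * the (mat_inverse (1\<^sub>m (N - NgS) - T_RR N NgS a))"

definition strongly_convex_on :: "'v::real_inner set \<Rightarrow> ('v \<Rightarrow> real) \<Rightarrow> bool" where
  "strongly_convex_on C f \<longleftrightarrow> (\<exists>\<nu>>0. convex_on C (\<lambda>w. f w - (\<nu> / 2) * (norm w)\<^sup>2))"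

text \<open>Filtration F_{i-1}: sigma-algebra generated by all iterates w_{l,j}, j <= i-1.
  Iterates are indexed with a shift: w n k denotes w_{k,n-1}; so filt P N w n is F_{n-1}.\<close>
definition filt :: "'o measure \<Rightarrow> nat \<Rightarrow> (nat \<Rightarrow> nat \<Rightarrow> 'o \<Rightarrow> 'v::topological_space) \<Rightarrow> nat \<Rightarrow> 'o measure" where
  "filt P N w n = sigma (space P)
     {w j l -` B \<inter> space P | j l B. j \<le> n \<and> l < N \<and> B \<in> sets borel}"

end

theory Submission
  imports Defs "Jordan_Normal_Form.Determinant"
begin

text \<open>The limit points satisfy \<open>w\<^sub>k\<^sup>\<star> = \<Sum>\<^sub>l a\<^sub>l\<^sub>k w\<^sub>l\<^sup>\<star>\<close> for every agent, so the errors obey the same linear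
  recursion as the iterates, forced by gradients and noise of order \<open>\<mu>\<close>.

  In a sub-network of group \<open>S\<close>, split the errors into their Perron average and the disagreement with
  it. The combination step preserves the average and contracts the disagreement at a rate independent
  of \<open>\<mu>\<close> in a suitable quadratic norm \<open>V\<close> (a sum of weighted squares over the first \<open>m\<close> powers of the
  matrix). The average performs a gradient step on a strongly monotone field, which contracts by
  \<open>1 - \<mu>\<nu>\<close>; only here is the martingale property of the noise needed. Hence
  \<open>E Z' \<le> (1 - \<mu>\<nu>/4) E Z + O(\<mu>\<^sup>2)\<close> for \<open>Z\<close> the squared average plus \<open>V\<close> of the disagreement, so
  \<open>limsup E Z = O(\<mu>)\<close>.

  In group \<open>R\<close>, a maximum principle shows that \<open>I - T\<^sub>R\<^sub>R\<close> is invertible. The solution of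
  \<open>h = 1 + T\<^sub>R\<^sub>R\<^sup>T h\<close> is then at least 1 and provides weights for which \<open>T\<^sub>R\<^sub>R\<^sup>T\<close> contracts a
  weighted maximum norm, and the group \<open>S\<close> errors enter as a forcing term of order \<open>\<mu>\<close>.\<close>

section \<open>Elementary inequalities and recursions\<close>

text \<open>Two rates compete. The average contracts only by a factor 1 - O(\<mu>), so its forcing
  must have order \<mu>^2 for the quotient to be of order \<mu>. An estimate of the noise cross term
  by absolute values would have order \<mu>; it is therefore carried exactly until expectations are
  taken. Disagreement and the errors of group \<open>R\<close> contract at a rate free of \<mu>, and
  there perturbations can be split off by Young's inequality at the price of a constant factor. Two
  feedbacks remain: gradients are evaluated at the scattered agents instead of their average, and
  the noise variance grows with the error. Both carry enough powers of \<mu> to be absorbed into the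
  contraction, which is where the step size has to be small.

  Threshold and constant must not depend on the run. Hence the drift inequality in group
  \<open>S\<close> is deterministic, and the mean-square bounds quantify over runs only after the
  constants are fixed. They are eventual bounds, which combine over finitely many agents and can
  serve as hypotheses for the next group.\<close>

lemma norm_add_power2_le:
  fixes x y :: "'v::real_inner"
  assumes "\<eta> > 0"
  shows "(norm (x + y))\<^sup>2 \<le> (1 + \<eta>) * (norm x)\<^sup>2 + (1 + 1 / \<eta>) * (norm y)\<^sup>2"
proof -
  \<comment> \<open>Young's inequality by completing the square. The free \<eta> keeps the factor of
    \<open>x\<close> close to 1, so that a contraction survives the perturbation
    \<open>y\<close>.\<close>
  have "0 \<le> (sqrt \<eta> * norm x - norm y / sqrt \<eta>)\<^sup>2" by simp
  also have "\<dots> = \<eta> * (norm x)\<^sup>2 + (norm y)\<^sup>2 / \<eta> - 2 * (norm x * norm y)"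
    using assms by (simp add: power2_diff power_mult_distrib power_divide)
  finally have "2 * (norm x * norm y) \<le> \<eta> * (norm x)\<^sup>2 + (norm y)\<^sup>2 / \<eta>" by simp
  moreover have "(norm (x + y))\<^sup>2 \<le> (norm x + norm y)\<^sup>2"
    by (intro power_mono norm_triangle_ineq) simp
  ultimately show ?thesis by (simp add: power2_sum algebra_simps)
qed

lemma norm_add_power2_le2:
  fixes x y :: "'v::real_inner"
  shows "(norm (x + y))\<^sup>2 \<le> 2 * (norm x)\<^sup>2 + 2 * (norm y)\<^sup>2"
  using norm_add_power2_le[of 1 x y] by simp

lemma norm_diff_power2_le2:
  fixes x y :: "'v::real_inner"
  shows "(norm (x - y))\<^sup>2 \<le> 2 * (norm x)\<^sup>2 + 2 * (norm y)\<^sup>2"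
  using norm_add_power2_le2[of x "- y"] by simp

text \<open>Cauchy-Schwarz after splitting each coefficient into sqrt (c h) and sqrt (c / h).
  Constant \<open>h\<close> gives a Jensen inequality; for weights with h = 1 + T^T h the first
  factor becomes h - 1, the source of the contraction in group \<open>R\<close>.\<close>

lemma norm_weighted_sum_power2_le:
  fixes x :: "'i \<Rightarrow> 'v::real_inner"
  assumes c: "\<And>l. l \<in> I \<Longrightarrow> 0 \<le> c l" and h: "\<And>l. l \<in> I \<Longrightarrow> 0 < h l"
  shows "(norm (\<Sum>l\<in>I. c l *\<^sub>R x l))\<^sup>2 \<le> (\<Sum>l\<in>I. c l * h l) * (\<Sum>l\<in>I. c l * ((norm (x l))\<^sup>2 / h l))"
proof -
  have "norm (\<Sum>l\<in>I. c l *\<^sub>R x l) \<le> (\<Sum>l\<in>I. c l * norm (x l))"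
    using c by (intro order_trans[OF norm_sum] sum_mono) auto
  also have "\<dots> = (\<Sum>l\<in>I. sqrt (c l * h l) * (sqrt (c l / h l) * norm (x l)))"
    by (rule sum.cong) (use c h in \<open>force simp: real_sqrt_mult real_sqrt_divide\<close>)+
  finally have "(norm (\<Sum>l\<in>I. c l *\<^sub>R x l))\<^sup>2
      \<le> (\<Sum>l\<in>I. sqrt (c l * h l) * (sqrt (c l / h l) * norm (x l)))\<^sup>2"
    by (intro power_mono) auto
  also have "\<dots> \<le> (\<Sum>l\<in>I. (sqrt (c l * h l))\<^sup>2) * (\<Sum>l\<in>I. (sqrt (c l / h l) * norm (x l))\<^sup>2)"
    by (rule Cauchy_Schwarz_ineq_sum)
  also have "\<dots> = (\<Sum>l\<in>I. c l * h l) * (\<Sum>l\<in>I. c l * ((norm (x l))\<^sup>2 / h l))"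
  proof -
    have "(\<Sum>l\<in>I. (sqrt (c l * h l))\<^sup>2) = (\<Sum>l\<in>I. c l * h l)"
      using c h by (intro sum.cong refl real_sqrt_pow2) (simp add: less_imp_le)
    moreover have "(\<Sum>l\<in>I. (sqrt (c l / h l) * norm (x l))\<^sup>2) = (\<Sum>l\<in>I. c l * ((norm (x l))\<^sup>2 / h l))"
      by (rule sum.cong) (use c h in \<open>auto simp: power_mult_distrib less_imp_le\<close>)
    ultimately show ?thesis by simp
  qed
  finally show ?thesis .
qed

lemma norm_weighted_sum_power2_le1:
  fixes x :: "'i \<Rightarrow> 'v::real_inner"
  assumes "\<And>l. l \<in> I \<Longrightarrow> 0 \<le> c l"
  shows "(norm (\<Sum>l\<in>I. c l *\<^sub>R x l))\<^sup>2 \<le> (\<Sum>l\<in>I. c l) * (\<Sum>l\<in>I. c l * (norm (x l))\<^sup>2)"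
  using norm_weighted_sum_power2_le[OF assms, where h = "\<lambda>_. 1"] by simp

text \<open>The excess over the fixed point b / (1 - q) of the affine map shrinks geometrically. The
  strict inequality for \<open>b'\<close> leaves the room that makes the bound hold from some index
  on and not merely in the limit.\<close>

lemma eventually_le_of_affine_recursion:
  fixes x :: "nat \<Rightarrow> real"
  assumes "0 \<le> q" "q < 1" and rec: "\<forall>\<^sub>F n in sequentially. x (Suc n) \<le> q * x n + b"
    and b': "b / (1 - q) < b'"
  shows "\<forall>\<^sub>F n in sequentially. x n \<le> b'"
proof -
  define f where "f = b / (1 - q)"
  have f: "q * f + b = f" using assms by (simp add: f_def field_simps)
  obtain n0 where n0: "\<And>n. n \<ge> n0 \<Longrightarrow> x (Suc n) \<le> q * x n + b"
    using rec unfolding eventually_sequentially by auto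
  have le: "x (n0 + k) \<le> f + q ^ k * (x n0 - f)" for k
  proof (induction k)
    case (Suc k)
    have "x (n0 + Suc k) \<le> q * x (n0 + k) + b" using n0[of "n0 + k"] by simp
    also have "\<dots> \<le> q * (f + q ^ k * (x n0 - f)) + b"
      using Suc assms by (simp add: mult_left_mono)
    also have "\<dots> = (q * f + b) + q ^ Suc k * (x n0 - f)" by (simp add: algebra_simps)
    finally show ?case by (simp only: f)
  qed simp
  have "(\<lambda>k. f + q ^ k * (x n0 - f)) \<longlonglongrightarrow> f + 0 * (x n0 - f)"
    using assms by (intro tendsto_intros LIMSEQ_power_zero) auto
  then have "\<forall>\<^sub>F k in sequentially. f + q ^ k * (x n0 - f) < b'"
    using b' by (intro order_tendstoD(2)) (auto simp: f_def)
  then have "\<forall>\<^sub>F k in sequentially. x (k + n0) \<le> b'"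
    by eventually_elim (metis add.commute le less_imp_le order_trans)
  then show ?thesis
    by (rule eventually_sequentially_seg[of "\<lambda>n. x n \<le> b'", THEN iffD1])
qed

text \<open>A comparison argument for the weighted maximum norm that never forms a maximum: the
  hypothesis turns every common bound \<open>y\<close> into a new one, and iterating it gives a
  scalar affine recursion.\<close>

lemma eventually_weighted_sup_le:
  fixes u :: "'i \<Rightarrow> nat \<Rightarrow> real"
  assumes fin: "finite K" and q: "0 \<le> q" "q < 1" and h: "\<And>k. k \<in> K \<Longrightarrow> h k > 0"
    and u: "\<And>k n. k \<in> K \<Longrightarrow> u k n \<ge> 0"
    and rec: "\<forall>\<^sub>F n in sequentially. \<forall>y\<ge>0. (\<forall>l\<in>K. u l n \<le> h l * y) \<longrightarrow> (\<forall>k\<in>K. u k (Suc n) \<le> h k * (q * y + b))"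
    and b': "b / (1 - q) < b'" and b: "b \<ge> 0"
  shows "\<forall>\<^sub>F n in sequentially. \<forall>k\<in>K. u k n \<le> h k * b'"
proof -
  obtain n0 where n0: "\<And>n y. n \<ge> n0 \<Longrightarrow> y \<ge> 0 \<Longrightarrow> \<forall>l\<in>K. u l n \<le> h l * y \<Longrightarrow> \<forall>k\<in>K. u k (Suc n) \<le> h k * (q * y + b)"
    using rec unfolding eventually_sequentially by blast
  \<comment> \<open>The sum of the ratios is the starting bound: it dominates each of them, is
    nonnegative, and makes sense for empty \<open>K\<close>.\<close>
  define y where "y = rec_nat (\<Sum>k\<in>K. u k n0 / h k) (\<lambda>_ z. q * z + b)"
  have y_simps [simp]: "y 0 = (\<Sum>k\<in>K. u k n0 / h k)" "\<And>n. y (Suc n) = q * y n + b"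
    by (simp_all add: y_def)
  have *: "y j \<ge> 0 \<and> (\<forall>k\<in>K. u k (n0 + j) \<le> h k * y j)" for j
  proof (induction j)
    case 0
    have "u k n0 / h k \<le> (\<Sum>k\<in>K. u k n0 / h k)" if "k \<in> K" for k
      using fin that u h by (intro member_le_sum) (auto simp: less_imp_le)
    moreover have "0 \<le> (\<Sum>k\<in>K. u k n0 / h k)"
      using u h by (intro sum_nonneg) (auto simp: less_imp_le)
    ultimately show ?case using h by (auto simp: divide_le_eq mult.commute)
  next
    case (Suc j)
    then show ?case using n0[of "n0 + j" "y j"] q b by auto
  qed
  have "\<forall>\<^sub>F j in sequentially. y j \<le> b'"
    by (rule eventually_le_of_affine_recursion[OF q _ b']) simp
  then have "\<forall>\<^sub>F j in sequentially. \<forall>k\<in>K. u k (j + n0) \<le> h k * b'"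
  proof eventually_elim
    case (elim j)
    then show ?case using *[of j] h
      by (metis add.commute less_imp_le mult_left_mono order_trans)
  qed
  then show ?thesis
    by (rule eventually_sequentially_seg[of "\<lambda>n. \<forall>k\<in>K. u k n \<le> h k * b'", THEN iffD1])
qed

lemma sub_mat_pow_nonneg:
  assumes "\<And>i j. i \<in> I \<Longrightarrow> j \<in> I \<Longrightarrow> 0 \<le> a i j" "i \<in> I" "j \<in> I"
  shows "0 \<le> sub_mat_pow I a m i j"
  using assms(3)
proof (induction m arbitrary: j)
  case (Suc m)
  then show ?case using assms by (auto intro!: sum_nonneg mult_nonneg_nonneg)
qed simp

section \<open>Contraction of a primitive left-stochastic matrix\<close>

text \<open>The exponent \<open>m\<close> is a parameter because \<open>V\<close> below depends on
  it. The vector \<open>p\<close> is the invariant distribution of the kernel that moves from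
  \<open>k\<close> to \<open>l\<close> with probability \<open>a l k\<close>.\<close>

locale perron_block =
  fixes I :: "nat set" and a :: "nat \<Rightarrow> nat \<Rightarrow> real" and p :: "nat \<Rightarrow> real" and m :: nat
  assumes finite_I: "finite I"
    and a_nonneg: "\<And>l k. l \<in> I \<Longrightarrow> k \<in> I \<Longrightarrow> 0 \<le> a l k"
    and a_stoch: "\<And>k. k \<in> I \<Longrightarrow> (\<Sum>l\<in>I. a l k) = 1"
    and perron: "\<And>l. l \<in> I \<Longrightarrow> (\<Sum>k\<in>I. a l k * p k) = p l"
    and p_pos: "\<And>k. k \<in> I \<Longrightarrow> 0 < p k"
    and p_sum: "(\<Sum>k\<in>I. p k) = 1"
    and m_pos: "0 < m"
    and pow_pos: "\<And>l k. l \<in> I \<Longrightarrow> k \<in> I \<Longrightarrow> 0 < sub_mat_pow I a m l k"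
begin

definition adj :: "(nat \<Rightarrow> 'v::real_inner) \<Rightarrow> nat \<Rightarrow> 'v"
  where "adj x k = (\<Sum>l\<in>I. a l k *\<^sub>R x l)"

definition avg :: "(nat \<Rightarrow> 'v::real_inner) \<Rightarrow> 'v"
  where "avg x = (\<Sum>k\<in>I. p k *\<^sub>R x k)"

definition psq :: "(nat \<Rightarrow> 'v::real_inner) \<Rightarrow> real"
  where "psq x = (\<Sum>k\<in>I. p k * (norm (x k))\<^sup>2)"

text \<open>\<open>psq\<close> need not drop strictly in one step, since only the
  \<open>m\<close>-th power is known to have positive entries. The sum over \<open>m\<close>
  consecutive iterates turns the loss over \<open>m\<close> steps into a loss in every step.\<close>

definition V :: "(nat \<Rightarrow> 'v::real_inner) \<Rightarrow> real"
  where "V x = (\<Sum>j<m. psq ((adj ^^ j) x))"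

lemma I_nonempty: "I \<noteq> {}"
  using p_sum by auto

lemma p_le_1: "k \<in> I \<Longrightarrow> p k \<le> 1"
  using member_le_sum[of k I p] p_sum p_pos finite_I by (auto simp: less_imp_le)

lemma psq_nonneg: "psq x \<ge> 0"
  unfolding psq_def using p_pos by (intro sum_nonneg) (auto simp: less_imp_le)

lemma psq_cong: "(\<And>k. k \<in> I \<Longrightarrow> x k = y k) \<Longrightarrow> psq x = psq y"
  by (simp add: psq_def)

lemma avg_cong: "(\<And>k. k \<in> I \<Longrightarrow> x k = y k) \<Longrightarrow> avg x = avg y"
  by (simp add: avg_def)

lemma adj_cong: "(\<And>k. k \<in> I \<Longrightarrow> x k = y k) \<Longrightarrow> adj x = adj y"
  by (simp add: adj_def fun_eq_iff)

lemma funpow_adj_cong: "(\<And>k. k \<in> I \<Longrightarrow> x k = y k) \<Longrightarrow> k \<in> I \<Longrightarrow> (adj ^^ j) x k = (adj ^^ j) y k"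
proof (induction j arbitrary: k)
  case (Suc j)
  then have "adj ((adj ^^ j) x) = adj ((adj ^^ j) y)" by (intro adj_cong) auto
  then show ?case by simp
qed simp

lemma V_cong: "(\<And>k. k \<in> I \<Longrightarrow> x k = y k) \<Longrightarrow> V x = V y"
  unfolding V_def by (intro sum.cong refl psq_cong funpow_adj_cong)

lemma avg_const: "avg (\<lambda>_. c) = c"
  by (simp add: avg_def scaleR_left.sum[symmetric] p_sum)

lemma avg_diff: "avg (\<lambda>k. x k - y k) = avg x - avg y"
  by (simp add: avg_def scaleR_diff_right sum_subtractf)

lemma avg_scaleR: "avg (\<lambda>k. c *\<^sub>R x k) = c *\<^sub>R avg x"
  by (simp add: avg_def scaleR_sum_right mult.commute)

lemma adj_const: "k \<in> I \<Longrightarrow> adj (\<lambda>_. c) k = c"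
  by (simp add: adj_def scaleR_left.sum[symmetric] a_stoch)

lemma adj_add: "adj (\<lambda>k. x k + y k) = (\<lambda>k. adj x k + adj y k)"
  by (simp add: adj_def scaleR_add_right sum.distrib fun_eq_iff)

lemma adj_diff: "adj (\<lambda>k. x k - y k) = (\<lambda>k. adj x k - adj y k)"
  by (simp add: adj_def scaleR_diff_right sum_subtractf fun_eq_iff)

lemma adj_scaleR: "adj (\<lambda>k. c *\<^sub>R x k) = (\<lambda>k. c *\<^sub>R adj x k)"
  by (simp add: adj_def scaleR_sum_right mult.commute fun_eq_iff)

text \<open>This is p^T A^T x = (A p)^T x with A p = p.\<close>

lemma avg_adj: "avg (adj x) = avg x"
proof -
  have "avg (adj x) = (\<Sum>k\<in>I. \<Sum>l\<in>I. (a l k * p k) *\<^sub>R x l)"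
    by (simp add: avg_def adj_def scaleR_sum_right mult.commute)
  also have "\<dots> = (\<Sum>l\<in>I. (\<Sum>k\<in>I. a l k * p k) *\<^sub>R x l)"
    by (subst sum.swap) (simp add: scaleR_sum_left)
  finally show ?thesis by (simp add: avg_def perron)
qed

lemma funpow_adj_add: "(adj ^^ j) (\<lambda>k. x k + y k) = (\<lambda>k. (adj ^^ j) x k + (adj ^^ j) y k)"
  by (induction j) (simp_all add: adj_add)

lemma funpow_adj_scaleR: "(adj ^^ j) (\<lambda>k. c *\<^sub>R x k) = (\<lambda>k. c *\<^sub>R (adj ^^ j) x k)"
  by (induction j) (simp_all add: adj_scaleR)

lemma funpow_adj: "k \<in> I \<Longrightarrow> (adj ^^ j) x k = (\<Sum>l\<in>I. sub_mat_pow I a j l k *\<^sub>R x l)"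
proof (induction j arbitrary: k)
  case 0
  then have "(\<Sum>l\<in>I. (if l = k then 1 else 0) *\<^sub>R x l) = (\<Sum>l\<in>I. if l = k then x l else 0)"
    by (intro sum.cong) auto
  then show ?case using 0 finite_I by simp
next
  case (Suc j)
  have "(adj ^^ Suc j) x k = (\<Sum>l\<in>I. a l k *\<^sub>R (\<Sum>i\<in>I. sub_mat_pow I a j i l *\<^sub>R x i))"
    using Suc.IH by (simp add: adj_def[of "(adj ^^ j) x"])
  also have "\<dots> = (\<Sum>l\<in>I. \<Sum>i\<in>I. (sub_mat_pow I a j i l * a l k) *\<^sub>R x i)"
    by (simp add: scaleR_sum_right mult.commute)
  also have "\<dots> = (\<Sum>i\<in>I. sub_mat_pow I a (Suc j) i k *\<^sub>R x i)"
    by (subst sum.swap) (simp add: scaleR_sum_left)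
  finally show ?case .
qed

lemma sub_mat_pow_stoch:
  assumes "k \<in> I" shows "(\<Sum>l\<in>I. sub_mat_pow I a j l k) = 1"
proof -
  have "(adj ^^ j) (\<lambda>_. 1::real) k = 1"
    using assms by (induction j arbitrary: k) (simp_all add: adj_def a_stoch cong: sum.cong)
  then show ?thesis using funpow_adj[OF assms, of j "\<lambda>_. 1::real"] by simp
qed

lemma sub_mat_pow_perron: "l \<in> I \<Longrightarrow> (\<Sum>k\<in>I. sub_mat_pow I a j l k * p k) = p l"
proof (induction j)
  case 0
  have "(\<Sum>k\<in>I. (if l = k then 1 else 0) * p k) = (\<Sum>k\<in>I. if l = k then p k else 0)"
    by (intro sum.cong) auto
  then show ?case using 0 finite_I by simp
next
  case (Suc j)
  have "(\<Sum>k\<in>I. sub_mat_pow I a (Suc j) l k * p k)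
      = (\<Sum>k\<in>I. \<Sum>i\<in>I. sub_mat_pow I a j l i * (a i k * p k))"
    by (simp add: sum_distrib_right mult.assoc)
  also have "\<dots> = (\<Sum>i\<in>I. sub_mat_pow I a j l i * (\<Sum>k\<in>I. a i k * p k))"
    by (subst sum.swap) (simp add: sum_distrib_left)
  finally show ?case using Suc by (simp add: perron)
qed

text \<open>Jensen in each column, whose entries form a probability vector; summed against
  \<open>p\<close>, the weights collapse to \<open>p\<close> again by the Perron equation.\<close>

lemma psq_adj_le: "psq (adj x) \<le> psq x"
proof -
  have "psq (adj x) \<le> (\<Sum>k\<in>I. p k * (\<Sum>l\<in>I. a l k * (norm (x l))\<^sup>2))"
    unfolding psq_def adj_def
  proof (intro sum_mono mult_left_mono)
    fix k assume k: "k \<in> I"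
    show "(norm (\<Sum>l\<in>I. a l k *\<^sub>R x l))\<^sup>2 \<le> (\<Sum>l\<in>I. a l k * (norm (x l))\<^sup>2)"
      using norm_weighted_sum_power2_le1[of I "\<lambda>l. a l k" x] a_nonneg k by (simp add: a_stoch)
  qed (use p_pos in \<open>auto simp: less_imp_le\<close>)
  also have "\<dots> = (\<Sum>l\<in>I. (\<Sum>k\<in>I. a l k * p k) * (norm (x l))\<^sup>2)"
    unfolding sum_distrib_left sum_distrib_right by (subst sum.swap) (simp add: mult_ac)
  finally show ?thesis by (simp add: perron psq_def)
qed

lemma psq_funpow_adj_le: "psq ((adj ^^ j) x) \<le> psq x"
  by (induction j) (auto intro: order_trans[OF psq_adj_le])

text \<open>Bias-variance identity: under the probability weights \<open>p\<close>,
  \<open>avg\<close> is the mean and the last term the variance.\<close>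

lemma psq_decomp: "psq x = (norm (avg x))\<^sup>2 + psq (\<lambda>k. x k - avg x)"
proof -
  have "p k * (norm (x k - avg x))\<^sup>2
      = p k * (norm (x k))\<^sup>2 - 2 * inner (p k *\<^sub>R x k) (avg x) + p k * (norm (avg x))\<^sup>2" for k
    by (simp add: power2_norm_eq_inner inner_diff inner_commute algebra_simps)
  then have "psq (\<lambda>k. x k - avg x) = psq x - 2 * inner (avg x) (avg x) + (norm (avg x))\<^sup>2"
    unfolding psq_def
    by (simp add: sum.distrib sum_subtractf sum_distrib_left[symmetric] sum_distrib_right[symmetric]
      inner_sum_left[symmetric] p_sum avg_def[symmetric] del: inner_scaleR_left)
  then show ?thesis by (simp add: power2_norm_eq_inner)
qed

text \<open>Together with \<open>V_le_psq\<close> this makes \<open>V\<close> and \<open>psq\<close>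
  equivalent with constants 1 and \<open>m\<close>, independent of the step size.\<close>

lemma psq_le_V: "psq x \<le> V x"
  unfolding V_def using m_pos psq_nonneg
  by (intro order_trans[OF _ member_le_sum[of 0 "{..<m}"]]) auto

lemma V_nonneg: "V x \<ge> 0"
  using psq_le_V psq_nonneg order_trans by blast

lemma V_le_psq: "V x \<le> m * psq x"
  unfolding V_def using sum_mono[of "{..<m}" "\<lambda>j. psq ((adj ^^ j) x)" "\<lambda>_. psq x"]
  by (simp add: psq_funpow_adj_le)

lemma V_add_le:
  assumes "\<eta> > 0"
  shows "V (\<lambda>k. x k + y k) \<le> (1 + \<eta>) * V x + (1 + 1 / \<eta>) * V y"
proof -
  have "psq (\<lambda>k. f k + g k) \<le> (1 + \<eta>) * psq f + (1 + 1 / \<eta>) * psq g" for f g :: "nat \<Rightarrow> 'a"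
  proof -
    have "psq (\<lambda>k. f k + g k) \<le> (\<Sum>k\<in>I. p k * ((1 + \<eta>) * (norm (f k))\<^sup>2 + (1 + 1 / \<eta>) * (norm (g k))\<^sup>2))"
      unfolding psq_def using p_pos assms
      by (intro sum_mono mult_left_mono norm_add_power2_le) (auto simp: less_imp_le)
    then show ?thesis
      by (simp add: psq_def distrib_left sum.distrib sum_distrib_left mult.left_commute)
  qed
  then have "V (\<lambda>k. x k + y k) \<le> (\<Sum>j<m. (1 + \<eta>) * psq ((adj ^^ j) x) + (1 + 1 / \<eta>) * psq ((adj ^^ j) y))"
    unfolding V_def funpow_adj_add by (rule sum_mono)
  then show ?thesis by (simp add: V_def sum.distrib sum_distrib_left)
qed

lemma V_scaleR: "V (\<lambda>k. c *\<^sub>R x k) = c\<^sup>2 * V x"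
  by (simp add: V_def psq_def funpow_adj_scaleR power_mult_distrib sum_distrib_left mult.left_commute)

text \<open>Doeblin minorization: all entries of the m-th power dominate a fixed fraction of the
  rank-one matrix with columns p, and that rank-one part vanishes on vectors of zero average.\<close>

lemma psq_funpow_contract:
  obtains \<delta> where "0 < \<delta>" "\<delta> \<le> 1"
    "\<And>x :: nat \<Rightarrow> 'v::real_inner. avg x = 0 \<Longrightarrow> psq ((adj ^^ m) x) \<le> (1 - \<delta>) * psq x"
proof -
  define Q where "Q = sub_mat_pow I a m"
  \<comment> \<open>The extra element 1 in the minimum gives \<delta> \<le> 1, so that 1 - \<delta>
    is nonnegative.\<close>
  define \<delta> where "\<delta> = Min (insert 1 ((\<lambda>(l, k). Q l k) ` (I \<times> I)))"
  have \<delta>: "0 < \<delta>" "\<delta> \<le> 1" and \<delta>Q: "\<And>l k. l \<in> I \<Longrightarrow> k \<in> I \<Longrightarrow> \<delta> \<le> Q l k"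
    unfolding \<delta>_def using finite_I I_nonempty pow_pos
    by (auto simp: Q_def simp del: Min_insert intro!: Min_le)
  have Qp: "0 \<le> Q l k - \<delta> * p l" if "l \<in> I" "k \<in> I" for l k
  proof -
    have "\<delta> * p l \<le> \<delta> * 1" using \<delta> p_le_1 that by (intro mult_left_mono) auto
    then show ?thesis using \<delta>Q[OF that] by simp
  qed
  have col: "(\<Sum>l\<in>I. Q l k - \<delta> * p l) = 1 - \<delta>" if "k \<in> I" for k
    using that by (simp add: sum_subtractf Q_def sub_mat_pow_stoch sum_distrib_left[symmetric] p_sum)
  have "psq ((adj ^^ m) x) \<le> (1 - \<delta>) * psq x" if x: "avg x = 0" for x :: "nat \<Rightarrow> 'v"
  proof -
    have "(norm ((adj ^^ m) x k))\<^sup>2 \<le> (1 - \<delta>) * (\<Sum>l\<in>I. (Q l k - \<delta> * p l) * (norm (x l))\<^sup>2)"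
      if k: "k \<in> I" for k
    proof -
      \<comment> \<open>Since \<open>avg x\<close> vanishes, the rank-one part can be subtracted
        freely; a nonnegative combination of total mass 1 - \<delta> remains.\<close>
      have "(adj ^^ m) x k = (\<Sum>l\<in>I. Q l k *\<^sub>R x l) - \<delta> *\<^sub>R avg x"
        using k x by (simp add: funpow_adj Q_def)
      also have "\<dots> = (\<Sum>l\<in>I. (Q l k - \<delta> * p l) *\<^sub>R x l)"
        by (simp add: avg_def scaleR_diff_left sum_subtractf scaleR_sum_right)
      finally show ?thesis
        using norm_weighted_sum_power2_le1[of I "\<lambda>l. Q l k - \<delta> * p l" x] Qp k by (simp add: col)
    qed
    then have "psq ((adj ^^ m) x)
        \<le> (\<Sum>k\<in>I. p k * ((1 - \<delta>) * (\<Sum>l\<in>I. (Q l k - \<delta> * p l) * (norm (x l))\<^sup>2)))"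
      unfolding psq_def using p_pos by (intro sum_mono mult_left_mono) (auto simp: less_imp_le)
    also have "\<dots> = (1 - \<delta>) * (\<Sum>k\<in>I. \<Sum>l\<in>I. (Q l k * p k - \<delta> * p l * p k) * (norm (x l))\<^sup>2)"
      unfolding sum_distrib_left by (intro sum.cong refl) (simp add: algebra_simps)
    also have "(\<Sum>k\<in>I. \<Sum>l\<in>I. (Q l k * p k - \<delta> * p l * p k) * (norm (x l))\<^sup>2)
        = (\<Sum>l\<in>I. (\<Sum>k\<in>I. Q l k * p k - \<delta> * p l * p k) * (norm (x l))\<^sup>2)"
      by (subst sum.swap) (simp add: sum_distrib_right)
    also have "\<dots> = (1 - \<delta>) * psq x"
    proof -
      have "(\<Sum>k\<in>I. Q l k * p k - \<delta> * p l * p k) = (1 - \<delta>) * p l" if "l \<in> I" for l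
        using that by (simp add: sum_subtractf Q_def sub_mat_pow_perron sum_distrib_left[symmetric]
          p_sum left_diff_distrib)
      then show ?thesis unfolding psq_def sum_distrib_left
        by (intro sum.cong refl) (simp add: mult.assoc)
    qed
    \<comment> \<open>One factor 1 - \<delta> comes from the column sums, the other from the rows
      summed against \<open>p\<close>; a single one is kept.\<close>
    also have "(1 - \<delta>) * ((1 - \<delta>) * psq x) \<le> (1 - \<delta>) * (1 * psq x)"
      using \<delta> psq_nonneg[of x] by (intro mult_left_mono mult_right_mono) auto
    finally show ?thesis by simp
  qed
  with \<delta> show thesis using that by blast
qed

text \<open>Applying \<open>adj\<close> shifts the sum \<open>V\<close> by one index: the term
  \<open>psq x\<close> is exchanged for \<open>psq\<close> of the \<open>m\<close>-th iterate, and
  by the minorization at least \<delta> * psq x is lost. As \<open>V x\<close> is at most m * psq x,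
  this is a fraction \<delta> / m of \<open>V x\<close>.\<close>

lemma V_adj_contract:
  obtains \<rho> where "0 \<le> \<rho>" "\<rho> < 1"
    "\<And>x :: nat \<Rightarrow> 'v::real_inner. avg x = 0 \<Longrightarrow> V (adj x) \<le> \<rho> * V x"
proof -
  obtain \<delta> where \<delta>: "0 < \<delta>" "\<delta> \<le> 1"
    and con: "\<And>x :: nat \<Rightarrow> 'v. avg x = 0 \<Longrightarrow> psq ((adj ^^ m) x) \<le> (1 - \<delta>) * psq x"
    using psq_funpow_contract by blast
  have "V (adj x) \<le> (1 - \<delta> / m) * V x" if "avg x = 0" for x :: "nat \<Rightarrow> 'v"
  proof -
    have "V (adj x) = (\<Sum>j<m. psq ((adj ^^ Suc j) x))"
      by (simp only: V_def funpow_Suc_right o_apply)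
    also have "\<dots> = V x + psq ((adj ^^ m) x) - psq x"
      using sum.lessThan_Suc_shift[of "\<lambda>j. psq ((adj ^^ j) x)" m]
        sum.lessThan_Suc[of "\<lambda>j. psq ((adj ^^ j) x)" m] by (simp add: V_def)
    also have "\<dots> \<le> V x - \<delta> * psq x" using con[OF that] by (simp add: algebra_simps)
    also have "\<dots> \<le> V x - \<delta> * (V x / m)"
      using \<delta> m_pos V_le_psq[of x] by (simp add: divide_le_eq mult.commute)
    finally show ?thesis by (simp add: algebra_simps)
  qed
  moreover have "0 \<le> 1 - \<delta> / m" "1 - \<delta> / m < 1"
    using \<delta> m_pos by (auto simp: divide_le_eq)
  ultimately show thesis using that by blast
qed

end

section \<open>Mean-square drift inside one primitive sub-network\<close>

text \<open>\<open>\<tau> k * p k\<close> is the weight in the equation of the limit point, divided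
  by the maximal step size. Monotonicity is asked of the weighted sum of the gradients, measured
  from its zero \<open>z\<close>: one strongly convex cost among convex ones yields it.\<close>

locale diffusion_block = perron_block +
  fixes \<tau> :: "nat \<Rightarrow> real" and g :: "nat \<Rightarrow> 'v::real_inner \<Rightarrow> 'v" and L \<nu> :: real and z :: 'v
  assumes tau: "\<And>k. k \<in> I \<Longrightarrow> 0 < \<tau> k \<and> \<tau> k \<le> 1"
    and lipschitz: "\<And>k x y. k \<in> I \<Longrightarrow> norm (g k x - g k y) \<le> L * norm (x - y)"
    and nu_pos: "0 < \<nu>"
    and strong_mono: "\<And>x. \<nu> * (norm x)\<^sup>2 \<le> inner x (\<Sum>k\<in>I. (\<tau> k * p k) *\<^sub>R g k (z + x))"
    and equilibrium: "(\<Sum>k\<in>I. (\<tau> k * p k) *\<^sub>R g k z) = 0"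
begin

text \<open>The recursion for errors relative to \<open>z\<close>. As the columns of
  \<open>a\<close> sum to 1, \<open>z\<close> can be subtracted inside the sum; the iterate
  reappears as z + e in the gradient.\<close>

definition step :: "real \<Rightarrow> (nat \<Rightarrow> 'v) \<Rightarrow> (nat \<Rightarrow> 'v) \<Rightarrow> nat \<Rightarrow> 'v"
  where "step \<mu> e s k = (\<Sum>l\<in>I. a l k *\<^sub>R (e l - (\<tau> l * \<mu>) *\<^sub>R (g l (z + e l) + s l)))"

definition drift :: "(nat \<Rightarrow> 'v) \<Rightarrow> 'v"
  where "drift e = (\<Sum>k\<in>I. (\<tau> k * p k) *\<^sub>R g k (z + e k))"

definition noise :: "(nat \<Rightarrow> 'v) \<Rightarrow> 'v"
  where "noise s = (\<Sum>k\<in>I. (\<tau> k * p k) *\<^sub>R s k)"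

text \<open>Both parts enter with equal weight: disagreement leaks into the average with a
  coefficient of order \<mu>, which the \<mu>-free contraction gap of \<open>V\<close>
  absorbs.\<close>

definition Z :: "(nat \<Rightarrow> 'v) \<Rightarrow> real"
  where "Z e = (norm (avg e))\<^sup>2 + V (\<lambda>k. e k - avg e)"

lemma psq_le_Z: "psq e \<le> Z e"
  using psq_decomp[of e] psq_le_V[of "\<lambda>k. e k - avg e"] by (simp add: Z_def)

lemma Z_cong:
  assumes "\<And>k. k \<in> I \<Longrightarrow> e k = e' k"
  shows "Z e = Z e'"
  using V_cong[of "\<lambda>k. e k - avg e" "\<lambda>k. e' k - avg e"] avg_cong[OF assms] assms by (simp add: Z_def)

lemma norm_le_Z:
  assumes "k \<in> I" shows "p k * (norm (e k))\<^sup>2 \<le> Z e"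
proof -
  have "p k * (norm (e k))\<^sup>2 \<le> psq e"
    unfolding psq_def using assms finite_I p_pos
    by (intro member_le_sum[of k I "\<lambda>k. p k * (norm (e k))\<^sup>2"]) (auto simp: less_imp_le)
  then show ?thesis using psq_le_Z[of e] by simp
qed

lemma tau_p: "k \<in> I \<Longrightarrow> 0 \<le> \<tau> k * p k" "k \<in> I \<Longrightarrow> \<tau> k * p k \<le> p k"
  using tau[of k] p_pos[of k] by (auto simp: mult_left_le_one_le)

lemma tau_p_sum: "(\<Sum>k\<in>I. \<tau> k * p k) \<le> 1"
  using sum_mono[of I "\<lambda>k. \<tau> k * p k" p] tau_p p_sum by simp

text \<open>Jensen for the weights \<open>\<tau> k * p k\<close>, which sum to at most 1 and are
  dominated by \<open>p\<close>.\<close>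

lemma norm_tau_p_sum_le: "(norm (\<Sum>k\<in>I. (\<tau> k * p k) *\<^sub>R x k))\<^sup>2 \<le> psq x"
proof -
  have "(norm (\<Sum>k\<in>I. (\<tau> k * p k) *\<^sub>R x k))\<^sup>2 \<le> (\<Sum>k\<in>I. \<tau> k * p k) * (\<Sum>k\<in>I. (\<tau> k * p k) * (norm (x k))\<^sup>2)"
    by (rule norm_weighted_sum_power2_le1) (rule tau_p)
  also have "\<dots> \<le> 1 * (\<Sum>k\<in>I. (\<tau> k * p k) * (norm (x k))\<^sup>2)"
    using tau_p_sum tau_p by (intro mult_right_mono sum_nonneg) auto
  also have "\<dots> \<le> psq x"
    unfolding psq_def mult_1 using tau_p by (intro sum_mono mult_right_mono) auto
  finally show ?thesis .
qed

lemma psq_le_sum: "psq x \<le> (\<Sum>k\<in>I. (norm (x k))\<^sup>2)"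
  unfolding psq_def using p_le_1 p_pos
  by (intro sum_mono) (auto intro!: mult_left_le_one_le simp: less_imp_le)

lemma lipschitz_power2: "k \<in> I \<Longrightarrow> (norm (g k x - g k y))\<^sup>2 \<le> L\<^sup>2 * (norm (x - y))\<^sup>2"
  using power_mono[OF lipschitz, of k x y 2] by (simp add: power_mult_distrib)

text \<open>An inexact gradient step: the field at \<open>avg e\<close> contracts, and Lipschitz
  continuity bounds its mismatch with the gradients at the scattered points by the
  disagreement.\<close>

lemma center_step:
  assumes \<mu>: "0 < \<mu>"
  shows "(norm (avg e - \<mu> *\<^sub>R drift e))\<^sup>2
      \<le> (1 - \<mu> * \<nu> + 2 * \<mu>\<^sup>2 * L\<^sup>2) * (norm (avg e))\<^sup>2
        + (\<mu> * L\<^sup>2 / \<nu> + 2 * \<mu>\<^sup>2 * L\<^sup>2) * psq (\<lambda>k. e k - avg e)"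
proof -
  define b where "b = avg e"
  define D where "D = psq (\<lambda>k. e k - b)"
  define G where "G = (\<Sum>k\<in>I. (\<tau> k * p k) *\<^sub>R g k (z + b))"
  define q where "q = drift e - G"
  have psq_lip: "psq (\<lambda>k. g k (x k) - g k (y k)) \<le> L\<^sup>2 * psq (\<lambda>k. x k - y k)" for x y
    unfolding psq_def sum_distrib_left
  proof (rule sum_mono)
    fix k assume "k \<in> I"
    then show "p k * (norm (g k (x k) - g k (y k)))\<^sup>2 \<le> L\<^sup>2 * (p k * (norm (x k - y k))\<^sup>2)"
      using mult_left_mono[OF lipschitz_power2[of k "x k" "y k"], of "p k"] p_pos[of k]
      by (simp add: mult_ac less_imp_le)
  qed
  have "q = (\<Sum>k\<in>I. (\<tau> k * p k) *\<^sub>R (g k (z + e k) - g k (z + b)))"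
    by (simp add: q_def drift_def G_def scaleR_diff_right sum_subtractf)
  then have "(norm q)\<^sup>2 \<le> psq (\<lambda>k. g k (z + e k) - g k (z + b))"
    using norm_tau_p_sum_le by simp
  also have "\<dots> \<le> L\<^sup>2 * D" using psq_lip[of "\<lambda>k. z + e k" "\<lambda>k. z + b"] by (simp add: D_def)
  finally have q: "(norm q)\<^sup>2 \<le> L\<^sup>2 * D" .
  have "G = (\<Sum>k\<in>I. (\<tau> k * p k) *\<^sub>R (g k (z + b) - g k z))"
    by (simp add: equilibrium G_def scaleR_diff_right sum_subtractf)
  then have "(norm G)\<^sup>2 \<le> psq (\<lambda>k. g k (z + b) - g k z)"
    using norm_tau_p_sum_le by simp
  also have "\<dots> \<le> L\<^sup>2 * (norm b)\<^sup>2" using psq_lip[of "\<lambda>k. z + b" "\<lambda>k. z"]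
    by (simp add: psq_def sum_distrib_right[symmetric] p_sum)
  finally have G: "(norm G)\<^sup>2 \<le> L\<^sup>2 * (norm b)\<^sup>2" .
  have bG: "\<nu> * (norm b)\<^sup>2 \<le> inner b G" unfolding G_def by (rule strong_mono)
  \<comment> \<open>Young's inequality with weight \<nu>: the mismatch \<open>q\<close> consumes
    half of the gain 2 * \<nu> of strong monotonicity and leaves the rate 1 - \<mu> * \<nu>.\<close>
  have "0 \<le> (norm (\<nu> *\<^sub>R b + q))\<^sup>2 / \<nu>" using nu_pos by simp
  also have "\<dots> = \<nu> * (norm b)\<^sup>2 + 2 * inner b q + (norm q)\<^sup>2 / \<nu>"
    using nu_pos unfolding power2_norm_eq_inner
    by (simp add: inner_add inner_commute field_simps power2_eq_square)
  also have "\<dots> \<le> \<nu> * (norm b)\<^sup>2 + 2 * inner b q + L\<^sup>2 * D / \<nu>"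
    using q nu_pos by (simp add: divide_right_mono)
  finally have bq: "- 2 * inner b q \<le> \<nu> * (norm b)\<^sup>2 + L\<^sup>2 * D / \<nu>" by simp
  have "(norm (G + q))\<^sup>2 \<le> 2 * (L\<^sup>2 * (norm b)\<^sup>2) + 2 * (L\<^sup>2 * D)"
    using norm_add_power2_le2[of G q] G q by simp
  then have Gq: "\<mu>\<^sup>2 * (norm (G + q))\<^sup>2 \<le> \<mu>\<^sup>2 * (2 * (L\<^sup>2 * (norm b)\<^sup>2) + 2 * (L\<^sup>2 * D))"
    by (intro mult_left_mono) auto
  have "(norm (b - \<mu> *\<^sub>R drift e))\<^sup>2 = (norm (b - \<mu> *\<^sub>R (G + q)))\<^sup>2" by (simp add: q_def)
  also have "\<dots> = (norm b)\<^sup>2 + \<mu> * (- 2 * inner b G - 2 * inner b q) + \<mu>\<^sup>2 * (norm (G + q))\<^sup>2"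
    unfolding power2_norm_eq_inner
    by (simp add: inner_add inner_diff inner_commute algebra_simps power2_eq_square)
  also have "\<dots> \<le> (norm b)\<^sup>2 + \<mu> * (- 2 * (\<nu> * (norm b)\<^sup>2) + (\<nu> * (norm b)\<^sup>2 + L\<^sup>2 * D / \<nu>))
      + \<mu>\<^sup>2 * (2 * (L\<^sup>2 * (norm b)\<^sup>2) + 2 * (L\<^sup>2 * D))"
    by (intro add_mono Gq mult_left_mono order_refl) (use bG bq \<mu> in auto)
  also have "\<dots> = (1 - \<mu> * \<nu> + 2 * \<mu>\<^sup>2 * L\<^sup>2) * (norm b)\<^sup>2
        + (\<mu> * L\<^sup>2 / \<nu> + 2 * \<mu>\<^sup>2 * L\<^sup>2) * D"
    by (simp add: algebra_simps)
  finally show ?thesis by (simp add: D_def b_def)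
qed

lemma avg_step: "avg (step \<mu> e s) = (avg e - \<mu> *\<^sub>R drift e) - \<mu> *\<^sub>R noise s"
proof -
  have "step \<mu> e s = adj (\<lambda>l. e l - (\<tau> l * \<mu>) *\<^sub>R (g l (z + e l) + s l))"
    by (simp add: step_def adj_def fun_eq_iff)
  then have "avg (step \<mu> e s) = avg e - avg (\<lambda>l. (\<tau> l * \<mu>) *\<^sub>R (g l (z + e l) + s l))"
    by (simp add: avg_adj avg_diff)
  also have "avg (\<lambda>l. (\<tau> l * \<mu>) *\<^sub>R (g l (z + e l) + s l)) = \<mu> *\<^sub>R drift e + \<mu> *\<^sub>R noise s"
    by (simp add: avg_def drift_def noise_def scaleR_sum_right sum.distrib[symmetric] scaleR_add_right mult_ac)
  finally show ?thesis by simp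
qed

text \<open>At \<open>z\<close> the weighted sum of the gradients vanishes but the single
  \<open>g l z\<close> need not; the middle term records this persistent push of the agents away
  from agreement.\<close>

lemma psq_drive_le:
  "psq (\<lambda>l. \<tau> l *\<^sub>R (g l (z + e l) + s l))
     \<le> 4 * L\<^sup>2 * psq e + 4 * (\<Sum>l\<in>I. (norm (g l z))\<^sup>2) + 2 * (\<Sum>l\<in>I. (norm (s l))\<^sup>2)"
proof -
  have "(norm (\<tau> l *\<^sub>R (g l (z + e l) + s l)))\<^sup>2
      \<le> 4 * L\<^sup>2 * (norm (e l))\<^sup>2 + 4 * (norm (g l z))\<^sup>2 + 2 * (norm (s l))\<^sup>2" if "l \<in> I" for l
  proof -
    have "(norm (\<tau> l *\<^sub>R (g l (z + e l) + s l)))\<^sup>2 \<le> (norm (g l (z + e l) + s l))\<^sup>2"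
      using tau[OF that] by (intro power_mono) (auto simp: mult_left_le_one_le)
    also have "\<dots> \<le> 2 * (norm (g l (z + e l)))\<^sup>2 + 2 * (norm (s l))\<^sup>2" by (rule norm_add_power2_le2)
    also have "(norm (g l (z + e l)))\<^sup>2 \<le> 2 * (norm (g l (z + e l) - g l z))\<^sup>2 + 2 * (norm (g l z))\<^sup>2"
      using norm_add_power2_le2[of "g l (z + e l) - g l z" "g l z"] by simp
    also have "(norm (g l (z + e l) - g l z))\<^sup>2 \<le> L\<^sup>2 * (norm (e l))\<^sup>2"
      using lipschitz_power2[OF that, of "z + e l" z] by simp
    finally show ?thesis by simp
  qed
  then have "psq (\<lambda>l. \<tau> l *\<^sub>R (g l (z + e l) + s l))
      \<le> (\<Sum>l\<in>I. p l * (4 * L\<^sup>2 * (norm (e l))\<^sup>2 + 4 * (norm (g l z))\<^sup>2 + 2 * (norm (s l))\<^sup>2))"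
    unfolding psq_def using p_pos by (intro sum_mono mult_left_mono) (auto simp: less_imp_le)
  also have "\<dots> = 4 * L\<^sup>2 * psq e + 4 * psq (\<lambda>l. g l z) + 2 * psq s"
    by (simp add: psq_def sum.distrib sum_distrib_left algebra_simps)
  finally show ?thesis using psq_le_sum[of s] psq_le_sum[of "\<lambda>l. g l z"] by simp
qed

lemma disagreement_step:
  obtains \<rho> C where "\<rho> < 1" "0 \<le> C"
    "\<And>\<mu> e s. V (\<lambda>k. step \<mu> e s k - avg (step \<mu> e s)) \<le> \<rho> * V (\<lambda>k. e k - avg e)
       + C * \<mu>\<^sup>2 * (psq e + 1 + (\<Sum>l\<in>I. (norm (s l))\<^sup>2))"
proof -
  obtain r where r: "0 \<le> r" "r < 1"
    and contract: "\<And>x :: nat \<Rightarrow> 'v. avg x = 0 \<Longrightarrow> V (adj x) \<le> r * V x"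
    using V_adj_contract by blast
  \<comment> \<open>This choice spends half of the gap 1 - r on Young's inequality: \<rho> is at
    most (1 + r) / 2.\<close>
  define \<eta> where "\<eta> = (1 - r) / 2"
  have \<eta>: "0 < \<eta>" using r by (simp add: \<eta>_def)
  define \<rho> where "\<rho> = (1 + \<eta>) * r"
  have "\<rho> = r + (1 - r) * r / 2" by (simp add: \<rho>_def \<eta>_def distrib_right)
  also have "\<dots> \<le> r + (1 - r) / 2" using r mult_left_le[of r "1 - r"] by simp
  also have "\<dots> < 1" using r by (simp add: field_simps)
  finally have \<rho>: "\<rho> < 1" .
  define g0 where "g0 = (\<Sum>l\<in>I. (norm (g l z))\<^sup>2)"
  have g0: "0 \<le> g0" by (simp add: g0_def sum_nonneg)
  \<comment> \<open>The factors are the price of Young's inequality, the equivalence constant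
    between \<open>V\<close> and \<open>psq\<close>, and the coefficients of
    \<open>psq_drive_le\<close>.\<close>
  define C where "C = (1 + 1 / \<eta>) * m * (4 * L\<^sup>2 + 4 * g0 + 2)"
  have "0 \<le> C" using \<eta> g0 by (simp add: C_def)
  moreover have "V (\<lambda>k. step \<mu> e s k - avg (step \<mu> e s)) \<le> \<rho> * V (\<lambda>k. e k - avg e)
       + C * \<mu>\<^sup>2 * (psq e + 1 + (\<Sum>l\<in>I. (norm (s l))\<^sup>2))" for \<mu> e s
  proof -
    define t where "t = (\<lambda>l. \<tau> l *\<^sub>R (g l (z + e l) + s l))"
    define d where "d = (\<lambda>k. e k - avg e)"
    define y where "y = adj (\<lambda>l. t l - avg t)"
    \<comment> \<open>Since \<open>adj\<close> fixes constants and preserves the average,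
      subtracting the new average centres error and push separately; \<open>d\<close> has average
      zero, so the contraction applies to it.\<close>
    have "step \<mu> e s k - avg (step \<mu> e s) = adj d k + (- \<mu>) *\<^sub>R y k" if "k \<in> I" for k
    proof -
      have st: "step \<mu> e s = adj (\<lambda>l. e l - \<mu> *\<^sub>R t l)"
        by (simp add: step_def t_def adj_def fun_eq_iff mult.commute)
      have "avg (step \<mu> e s) = avg e - \<mu> *\<^sub>R avg t"
        unfolding st by (simp add: avg_adj avg_diff avg_scaleR)
      then show ?thesis
        using that unfolding st d_def y_def adj_diff adj_scaleR
        by (simp add: adj_const algebra_simps)
    qed
    then have "V (\<lambda>k. step \<mu> e s k - avg (step \<mu> e s)) = V (\<lambda>k. adj d k + (- \<mu>) *\<^sub>R y k)"
      by (rule V_cong)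
    also have "\<dots> \<le> (1 + \<eta>) * V (adj d) + (1 + 1 / \<eta>) * (\<mu>\<^sup>2 * V y)"
      using V_add_le[OF \<eta>, of "adj d" "\<lambda>k. (- \<mu>) *\<^sub>R y k"] V_scaleR[of "- \<mu>" y] by simp
    also have "(1 + \<eta>) * V (adj d) \<le> \<rho> * V d"
      using mult_left_mono[OF contract[of d], of "1 + \<eta>"] \<eta>
      by (simp add: \<rho>_def d_def avg_diff avg_const mult.assoc)
    also have "(1 + 1 / \<eta>) * (\<mu>\<^sup>2 * V y) \<le> C * \<mu>\<^sup>2 * (psq e + 1 + (\<Sum>l\<in>I. (norm (s l))\<^sup>2))"
    proof -
      define \<Sigma> where "\<Sigma> = (\<Sum>l\<in>I. (norm (s l))\<^sup>2)"
      have \<Sigma>: "0 \<le> \<Sigma>" by (simp add: \<Sigma>_def sum_nonneg)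
      have "psq y \<le> psq (\<lambda>l. t l - avg t)" unfolding y_def by (rule psq_adj_le)
      also have "\<dots> \<le> psq t" using psq_decomp[of t] by simp
      also have "\<dots> \<le> 4 * L\<^sup>2 * psq e + 4 * g0 + 2 * \<Sigma>"
        unfolding t_def g0_def \<Sigma>_def by (rule psq_drive_le)
      also have "\<dots> \<le> (4 * L\<^sup>2 + 4 * g0 + 2) * (psq e + 1 + \<Sigma>)"
        using g0 \<Sigma> psq_nonneg[of e] by (simp add: algebra_simps)
      finally have "psq y \<le> (4 * L\<^sup>2 + 4 * g0 + 2) * (psq e + 1 + \<Sigma>)" .
      then have "V y \<le> m * ((4 * L\<^sup>2 + 4 * g0 + 2) * (psq e + 1 + \<Sigma>))"
        using V_le_psq[of y] by (meson mult_left_mono of_nat_0_le_iff order_trans)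
      then have "(1 + 1 / \<eta>) * (\<mu>\<^sup>2 * V y)
        \<le> (1 + 1 / \<eta>) * (\<mu>\<^sup>2 * (m * ((4 * L\<^sup>2 + 4 * g0 + 2) * (psq e + 1 + \<Sigma>))))"
        using \<eta> by (intro mult_left_mono) auto
      then show ?thesis by (simp add: C_def \<Sigma>_def mult_ac)
    qed
    finally show ?thesis by (simp add: d_def)
  qed
  ultimately show thesis using that[of \<rho> C] \<rho> by blast
qed

text \<open>Adds the estimates for average and disagreement. In the inner product the left factor
  depends on \<open>e\<close> alone, so its expectation vanishes for noise of conditional mean
  zero.\<close>

lemma Z_step:
  obtains \<mu>0 K where "0 < \<mu>0" "0 \<le> K"
    "\<And>\<mu> e s. 0 < \<mu> \<Longrightarrow> \<mu> < \<mu>0 \<Longrightarrow>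
       Z (step \<mu> e s) \<le> (1 - \<mu> * \<nu> / 2) * Z e + K * \<mu>\<^sup>2 * (1 + (\<Sum>l\<in>I. (norm (s l))\<^sup>2))
         - 2 * \<mu> * inner (avg e - \<mu> *\<^sub>R drift e) (noise s)"
proof -
  obtain \<rho> C where \<rho>: "\<rho> < 1" and C: "0 \<le> C" and
    dis: "\<And>\<mu> e s. V (\<lambda>k. step \<mu> e s k - avg (step \<mu> e s)) \<le> \<rho> * V (\<lambda>k. e k - avg e)
       + C * \<mu>\<^sup>2 * (psq e + 1 + (\<Sum>l\<in>I. (norm (s l))\<^sup>2))"
    using disagreement_step by blast
  \<comment> \<open>Collects the coefficients of \<mu>^2: 2 * L^2 from the gradient step of the
    average, \<open>C\<close> from \<open>psq e\<close> in the disagreement estimate.\<close>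
  define c where "c = 2 * L\<^sup>2 + C"
  \<comment> \<open>Both inequalities are strict in the limit \<mu> = 0 and persist nearby. The
    first lets half of \<mu> * \<nu> absorb the second order terms, the second brings the
    disagreement factor below 1 - \<mu> * \<nu> / 2.\<close>
  have "\<forall>\<^sub>F \<mu> in at_right 0. - \<nu> / 2 + \<mu> * c < 0 \<and> \<rho> + \<mu> * L\<^sup>2 / \<nu> + \<mu>\<^sup>2 * c + \<mu> * \<nu> / 2 < 1"
  proof (rule eventually_conj)
    have "((\<lambda>\<mu>. - \<nu> / 2 + \<mu> * c) \<longlongrightarrow> - \<nu> / 2 + 0 * c) (at_right 0)"
      by (intro tendsto_intros)
    then show "\<forall>\<^sub>F \<mu> in at_right 0. - \<nu> / 2 + \<mu> * c < 0"
      using nu_pos by (intro order_tendstoD) auto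
    have "((\<lambda>\<mu>. \<rho> + \<mu> * L\<^sup>2 / \<nu> + \<mu>\<^sup>2 * c + \<mu> * \<nu> / 2)
        \<longlongrightarrow> \<rho> + 0 * L\<^sup>2 / \<nu> + 0\<^sup>2 * c + 0 * \<nu> / 2) (at_right 0)"
      using nu_pos by (intro tendsto_intros) auto
    then show "\<forall>\<^sub>F \<mu> in at_right 0. \<rho> + \<mu> * L\<^sup>2 / \<nu> + \<mu>\<^sup>2 * c + \<mu> * \<nu> / 2 < 1"
      using \<rho> by (intro order_tendstoD) auto
  qed
  then obtain \<mu>0 where \<mu>0: "0 < \<mu>0" and "\<forall>\<mu>>0. \<mu> < \<mu>0 \<longrightarrow>
      - \<nu> / 2 + \<mu> * c < 0 \<and> \<rho> + \<mu> * L\<^sup>2 / \<nu> + \<mu>\<^sup>2 * c + \<mu> * \<nu> / 2 < 1"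
    unfolding eventually_at_right_field by blast
  then have small: "\<And>\<mu>. 0 < \<mu> \<Longrightarrow> \<mu> < \<mu>0 \<Longrightarrow> - \<nu> / 2 + \<mu> * c < 0"
    "\<And>\<mu>. 0 < \<mu> \<Longrightarrow> \<mu> < \<mu>0 \<Longrightarrow> \<rho> + \<mu> * L\<^sup>2 / \<nu> + \<mu>\<^sup>2 * c + \<mu> * \<nu> / 2 < 1"
    by simp_all
  \<comment> \<open>The 1 added to \<open>C\<close> pays for the energy of the noise in the
    average.\<close>
  have "Z (step \<mu> e s) \<le> (1 - \<mu> * \<nu> / 2) * Z e + (C + 1) * \<mu>\<^sup>2 * (1 + (\<Sum>l\<in>I. (norm (s l))\<^sup>2))
         - 2 * \<mu> * inner (avg e - \<mu> *\<^sub>R drift e) (noise s)" if \<mu>: "0 < \<mu>" "\<mu> < \<mu>0" for \<mu> e s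
  proof -
    define b where "b = (norm (avg e))\<^sup>2"
    define D where "D = V (\<lambda>k. e k - avg e)"
    define x where "x = avg e - \<mu> *\<^sub>R drift e"
    define \<Sigma> where "\<Sigma> = (\<Sum>l\<in>I. (norm (s l))\<^sup>2)"
    have b: "0 \<le> b" and D: "0 \<le> D" by (auto simp: b_def D_def V_nonneg)
    have pD: "psq (\<lambda>k. e k - avg e) \<le> D" by (simp add: D_def psq_le_V)
    have pe: "psq e \<le> b + D" using psq_le_Z[of e] by (simp add: Z_def b_def D_def)
    have "(norm x)\<^sup>2 \<le> (1 - \<mu> * \<nu> + 2 * \<mu>\<^sup>2 * L\<^sup>2) * b + (\<mu> * L\<^sup>2 / \<nu> + 2 * \<mu>\<^sup>2 * L\<^sup>2) * psq (\<lambda>k. e k - avg e)"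
      unfolding x_def b_def by (rule center_step[OF \<mu>(1)])
    also have "\<dots> \<le> (1 - \<mu> * \<nu> + 2 * \<mu>\<^sup>2 * L\<^sup>2) * b + (\<mu> * L\<^sup>2 / \<nu> + 2 * \<mu>\<^sup>2 * L\<^sup>2) * D"
      using pD \<mu> nu_pos by (intro add_left_mono mult_left_mono) auto
    finally have x: "(norm x)\<^sup>2 \<le> (1 - \<mu> * \<nu> + 2 * \<mu>\<^sup>2 * L\<^sup>2) * b + (\<mu> * L\<^sup>2 / \<nu> + 2 * \<mu>\<^sup>2 * L\<^sup>2) * D" .
    have "(norm (noise s))\<^sup>2 \<le> \<Sigma>"
      unfolding noise_def \<Sigma>_def using norm_tau_p_sum_le[of s] psq_le_sum[of s] by simp
    then have ns: "\<mu>\<^sup>2 * (norm (noise s))\<^sup>2 \<le> \<mu>\<^sup>2 * \<Sigma>" by (intro mult_left_mono) auto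
    have av: "(norm (avg (step \<mu> e s)))\<^sup>2 = (norm x)\<^sup>2 - 2 * \<mu> * inner x (noise s) + \<mu>\<^sup>2 * (norm (noise s))\<^sup>2"
      unfolding avg_step x_def[symmetric] power2_norm_eq_inner
      by (simp add: inner_diff inner_commute algebra_simps power2_eq_square)
    have "C * \<mu>\<^sup>2 * (psq e + 1 + \<Sigma>) \<le> C * \<mu>\<^sup>2 * (b + D + 1 + \<Sigma>)"
      using C pe by (intro mult_left_mono) auto
    then have dv: "V (\<lambda>k. step \<mu> e s k - avg (step \<mu> e s)) \<le> \<rho> * D + C * \<mu>\<^sup>2 * (b + D + 1 + \<Sigma>)"
      using dis[of \<mu> e s] by (simp add: D_def \<Sigma>_def)
    have "Z (step \<mu> e s) \<le> (1 - \<mu> * \<nu> + \<mu>\<^sup>2 * c) * b + (\<rho> + \<mu> * L\<^sup>2 / \<nu> + \<mu>\<^sup>2 * c) * D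
        + C * \<mu>\<^sup>2 * (1 + \<Sigma>) + \<mu>\<^sup>2 * \<Sigma> - 2 * \<mu> * inner x (noise s)"
      using x ns dv unfolding Z_def[of "step \<mu> e s"] av by (simp add: c_def algebra_simps)
    also have "1 - \<mu> * \<nu> + \<mu>\<^sup>2 * c \<le> 1 - \<mu> * \<nu> / 2"
    proof -
      have "\<mu> * (- \<nu> / 2 + \<mu> * c) \<le> 0"
        using small(1)[OF \<mu>] \<mu> by (intro mult_nonneg_nonpos) auto
      then show ?thesis by (simp add: algebra_simps power2_eq_square)
    qed
    also have "\<rho> + \<mu> * L\<^sup>2 / \<nu> + \<mu>\<^sup>2 * c \<le> 1 - \<mu> * \<nu> / 2" using small(2)[OF \<mu>] by simp
    finally have "Z (step \<mu> e s) \<le> (1 - \<mu> * \<nu> / 2) * b + (1 - \<mu> * \<nu> / 2) * D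
        + C * \<mu>\<^sup>2 * (1 + \<Sigma>) + \<mu>\<^sup>2 * \<Sigma> - 2 * \<mu> * inner x (noise s)"
      using b D by (simp add: mult_right_mono)
    moreover have "(1 - \<mu> * \<nu> / 2) * Z e = (1 - \<mu> * \<nu> / 2) * b + (1 - \<mu> * \<nu> / 2) * D"
      by (simp add: Z_def b_def D_def distrib_left)
    moreover have "C * \<mu>\<^sup>2 * (1 + \<Sigma>) + \<mu>\<^sup>2 * \<Sigma> \<le> (C + 1) * \<mu>\<^sup>2 * (1 + \<Sigma>)"
      by (simp add: algebra_simps)
    ultimately show ?thesis by (simp add: x_def \<Sigma>_def)
  qed
  then show thesis using that[of \<mu>0 "C + 1"] \<mu>0 C by simp
qed

end

section \<open>Square-integrable random vectors\<close>

definition sq_int :: "'o measure \<Rightarrow> ('o \<Rightarrow> 'v::euclidean_space) \<Rightarrow> bool"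
  where "sq_int M X \<longleftrightarrow> X \<in> borel_measurable M \<and> integrable M (\<lambda>x. (norm (X x))\<^sup>2)"

lemma sq_int_measurable: "sq_int M X \<Longrightarrow> X \<in> borel_measurable M"
  and sq_int_integrable: "sq_int M X \<Longrightarrow> integrable M (\<lambda>x. (norm (X x))\<^sup>2)"
  by (simp_all add: sq_int_def)

lemma sq_int_add:
  assumes "sq_int M X" "sq_int M Y"
  shows "sq_int M (\<lambda>x. X x + Y x)"
proof -
  have [measurable]: "X \<in> borel_measurable M" "Y \<in> borel_measurable M"
    using assms by (simp_all add: sq_int_def)
  have "integrable M (\<lambda>x. (norm (X x + Y x))\<^sup>2)"
    by (rule Bochner_Integration.integrable_bound[of _ "\<lambda>x. 2 * (norm (X x))\<^sup>2 + 2 * (norm (Y x))\<^sup>2"])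
       (use assms in \<open>auto simp: sq_int_def norm_add_power2_le2\<close>)
  then show ?thesis by (simp add: sq_int_def)
qed

lemma sq_int_scaleR: "sq_int M X \<Longrightarrow> sq_int M (\<lambda>x. c *\<^sub>R X x)"
  by (auto simp: sq_int_def power_mult_distrib)

lemma sq_int_diff: "sq_int M X \<Longrightarrow> sq_int M Y \<Longrightarrow> sq_int M (\<lambda>x. X x - Y x)"
  using sq_int_add[of M X "\<lambda>x. (- 1) *\<^sub>R Y x"] sq_int_scaleR[of M Y "- 1"] by simp

lemma (in finite_measure) sq_int_const: "sq_int M (\<lambda>_. c)"
  by (simp add: sq_int_def)

lemma (in finite_measure) sq_int_sum: "(\<And>i. i \<in> A \<Longrightarrow> sq_int M (X i)) \<Longrightarrow> sq_int M (\<lambda>x. \<Sum>i\<in>A. X i x)"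
  by (induction A rule: infinite_finite_induct) (auto simp: sq_int_const intro: sq_int_add)

lemma (in finite_measure) sq_int_lipschitz:
  assumes f: "continuous_on UNIV f" "\<And>x y. norm (f x - f y) \<le> L * norm (x - y)" and X: "sq_int M X"
  shows "sq_int M (\<lambda>x. f (X x))"
proof -
  have [measurable]: "X \<in> borel_measurable M" using X by (simp add: sq_int_def)
  have f_meas [measurable]: "(\<lambda>x. f (X x)) \<in> borel_measurable M"
    by (rule borel_measurable_continuous_on[OF f(1)]) measurable
  have "integrable M (\<lambda>x. (norm (f (X x)))\<^sup>2)"
  proof (rule Bochner_Integration.integrable_bound[of _ "\<lambda>x. 2 * (L\<^sup>2 * (norm (X x))\<^sup>2) + 2 * (norm (f 0))\<^sup>2"])
    show "AE x in M. norm ((norm (f (X x)))\<^sup>2) \<le> norm (2 * (L\<^sup>2 * (norm (X x))\<^sup>2) + 2 * (norm (f 0))\<^sup>2)"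
    proof (rule AE_I2)
      fix x
      have "(norm (f (X x)))\<^sup>2 \<le> 2 * (norm (f (X x) - f 0))\<^sup>2 + 2 * (norm (f 0))\<^sup>2"
        using norm_add_power2_le2[of "f (X x) - f 0" "f 0"] by simp
      moreover have "(norm (f (X x) - f 0))\<^sup>2 \<le> L\<^sup>2 * (norm (X x))\<^sup>2"
        using power_mono[OF f(2)[of "X x" 0], of 2] by (simp add: power_mult_distrib)
      ultimately show "norm ((norm (f (X x)))\<^sup>2) \<le> norm (2 * (L\<^sup>2 * (norm (X x))\<^sup>2) + 2 * (norm (f 0))\<^sup>2)"
        by simp
    qed
  qed (use X in \<open>auto simp: sq_int_def\<close>)
  then show ?thesis by (simp add: sq_int_def)
qed

lemma sq_int_mult:
  fixes X Y :: "'o \<Rightarrow> real"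
  assumes "sq_int M X" "sq_int M Y"
  shows "integrable M (\<lambda>x. X x * Y x)"
proof -
  have [measurable]: "X \<in> borel_measurable M" "Y \<in> borel_measurable M"
    using assms by (simp_all add: sq_int_def)
  show ?thesis
  proof (rule Bochner_Integration.integrable_bound[of _ "\<lambda>x. (X x)\<^sup>2 + (Y x)\<^sup>2"])
    have "\<bar>X x * Y x\<bar> \<le> (X x)\<^sup>2 + (Y x)\<^sup>2" for x
    proof -
      have "\<bar>X x * Y x\<bar> \<le> 2 * \<bar>X x\<bar> * \<bar>Y x\<bar>" by (simp add: abs_mult)
      also have "\<dots> \<le> \<bar>X x\<bar>\<^sup>2 + \<bar>Y x\<bar>\<^sup>2" by (rule sum_squares_bound)
      finally show ?thesis by simp
    qed
    then show "AE x in M. norm (X x * Y x) \<le> norm ((X x)\<^sup>2 + (Y x)\<^sup>2)" by simp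
  qed (use assms in \<open>auto simp: sq_int_def\<close>)
qed

lemma sq_int_nth:
  fixes X :: "'o \<Rightarrow> real^'M"
  assumes "sq_int M X"
  shows "sq_int M (\<lambda>x. X x $ j)"
proof -
  have [measurable]: "X \<in> borel_measurable M" using assms by (simp_all add: sq_int_def)
  have [measurable]: "(\<lambda>x. X x $ j) \<in> borel_measurable M"
    by (rule borel_measurable_continuous_on[of "\<lambda>v. v $ j"]) (auto intro: continuous_intros)
  have "(norm (X x $ j))\<^sup>2 \<le> (norm (X x))\<^sup>2" for x
    using component_le_norm_cart[of "X x" j] by (intro power_mono) auto
  then have "integrable M (\<lambda>x. (norm (X x $ j))\<^sup>2)"
    using assms
    by (intro Bochner_Integration.integrable_bound[of _ "\<lambda>x. (norm (X x))\<^sup>2" "\<lambda>x. (norm (X x $ j))\<^sup>2"])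
       (auto simp: sq_int_def)
  then show ?thesis by (simp add: sq_int_def)
qed

section \<open>The stochastic recursion\<close>

text \<open>One run at a fixed step size; the bounds below use this locale as a predicate under
  quantifiers, so that their constants precede the run. The index is shifted: \<open>w n k\<close>
  is the iterate at time n - 1, and \<open>s n k\<close> is the noise at that iterate, conditioned
  on \<open>filt P N w n\<close>.\<close>

locale diffusion_run = prob_space P for P :: "'o measure" +
  fixes N :: nat and a :: "nat \<Rightarrow> nat \<Rightarrow> real" and \<tau> \<beta> \<sigma> :: "nat \<Rightarrow> real"
    and g :: "nat \<Rightarrow> real^'M \<Rightarrow> real^'M" and wstar :: "nat \<Rightarrow> real^'M" and \<mu> :: real
    and w s :: "nat \<Rightarrow> nat \<Rightarrow> 'o \<Rightarrow> real^'M"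
  assumes w_meas: "\<And>n k. k < N \<Longrightarrow> w n k \<in> borel_measurable P"
    and s_meas: "\<And>n k. k < N \<Longrightarrow> s n k \<in> borel_measurable P"
    and w_0: "\<And>k. k < N \<Longrightarrow> integrable P (\<lambda>x. (norm (w 0 k x))\<^sup>2)"
    and w_Suc: "\<And>n k x. k < N \<Longrightarrow> x \<in> space P \<Longrightarrow> w (Suc n) k x
       = (\<Sum>l<N. a l k *\<^sub>R (w n l x - (\<tau> l * \<mu>) *\<^sub>R (g l (w n l x) + s n l x)))"
    and s_sq: "\<And>n k. k < N \<Longrightarrow> integrable P (\<lambda>x. (norm (s n k x))\<^sup>2)"
    and s_mean: "\<And>n k j. k < N \<Longrightarrow> AE x in P. real_cond_exp P (filt P N w n) (\<lambda>y. s n k y $ j) x = 0"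
    and s_var: "\<And>n k. k < N \<Longrightarrow> AE x in P.
       nn_cond_exp P (filt P N w n) (\<lambda>y. ennreal ((norm (s n k y))\<^sup>2)) x
         \<le> ennreal ((\<beta> k)\<^sup>2 * (norm (wstar k - w n k x))\<^sup>2 + (\<sigma> k)\<^sup>2)"
    and g_lipschitz: "\<And>k. k < N \<Longrightarrow> \<exists>L. \<forall>x y. norm (g k x - g k y) \<le> L * norm (x - y)"
begin

definition err :: "nat \<Rightarrow> nat \<Rightarrow> 'o \<Rightarrow> real^'M"
  where "err n k x = w n k x - wstar k"

text \<open>As a Bochner integral this would be 0 for an error that is not square integrable;
  \<open>sq_int_err\<close> excludes that case.\<close>

definition mse :: "nat \<Rightarrow> nat \<Rightarrow> real"
  where "mse k n = expectation (\<lambda>x. (norm (err n k x))\<^sup>2)"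

lemma mse_nonneg: "0 \<le> mse k n"
  by (simp add: mse_def)

lemma g_continuous: "k < N \<Longrightarrow> continuous_on UNIV (g k)"
proof -
  assume "k < N"
  then obtain L where L: "\<And>x y. norm (g k x - g k y) \<le> L * norm (x - y)"
    using g_lipschitz by blast
  have "(max L 0)-lipschitz_on UNIV (g k)"
    by (rule lipschitz_onI) (auto simp: dist_norm intro: order_trans[OF L mult_right_mono])
  then show ?thesis by (rule lipschitz_on_continuous_on)
qed

lemma sq_int_g: "k < N \<Longrightarrow> sq_int P X \<Longrightarrow> sq_int P (\<lambda>x. g k (X x))"
  using g_lipschitz sq_int_lipschitz[OF g_continuous] by blast

lemma sq_int_s: "k < N \<Longrightarrow> sq_int P (s n k)"
  by (simp add: sq_int_def s_meas s_sq)

text \<open>Induction along the recursion: Lipschitz gradients have linear growth and so preserve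
  square integrability.\<close>

lemma sq_int_w: "k < N \<Longrightarrow> sq_int P (w n k)"
proof (induction n arbitrary: k)
  case 0
  then show ?case by (simp add: sq_int_def w_meas w_0)
next
  case (Suc n)
  have "sq_int P (\<lambda>x. \<Sum>l<N. a l k *\<^sub>R (w n l x - (\<tau> l * \<mu>) *\<^sub>R (g l (w n l x) + s n l x)))"
    using Suc by (intro sq_int_sum sq_int_scaleR sq_int_diff sq_int_add sq_int_g sq_int_s) auto
  moreover have "integrable P (\<lambda>x. (norm (w (Suc n) k x))\<^sup>2) \<longleftrightarrow> integrable P (\<lambda>x.
      (norm (\<Sum>l<N. a l k *\<^sub>R (w n l x - (\<tau> l * \<mu>) *\<^sub>R (g l (w n l x) + s n l x))))\<^sup>2)"
    using Suc.prems by (intro Bochner_Integration.integrable_cong) (simp_all add: w_Suc)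
  ultimately show ?case using Suc.prems by (simp add: sq_int_def w_meas)
qed

lemma sq_int_err: "k < N \<Longrightarrow> sq_int P (err n k)"
  unfolding err_def[abs_def] by (intro sq_int_diff sq_int_w sq_int_const)

lemma filt_generators: "{w j l -` B \<inter> space P |j l B. j \<le> n \<and> l < N \<and> B \<in> sets borel} \<subseteq> sets P"
  using w_meas by (auto intro: measurable_sets)

lemma sets_filt: "sets (filt P N w n)
    = sigma_sets (space P) {w j l -` B \<inter> space P |j l B. j \<le> n \<and> l < N \<and> B \<in> sets borel}"
  unfolding filt_def using filt_generators sets.space_closed by (intro sets_measure_of) blast

lemma space_filt: "space (filt P N w n) = space P"
  unfolding filt_def by (simp add: space_measure_of_conv)

lemma finite_measure_subalgebra_filt: "finite_measure_subalgebra P (filt P N w n)"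
proof
  show "subalgebra P (filt P N w n)"
    unfolding subalgebra_def space_filt sets_filt
    using sets.sigma_sets_subset[OF filt_generators] by simp
qed

lemma w_filt_measurable: "k < N \<Longrightarrow> w n k \<in> borel_measurable (filt P N w n)"
  by (rule measurableI) (auto simp: space_filt sets_filt intro!: sigma_sets.Basic)

text \<open>A martingale difference is orthogonal to every square integrable vector determined by
  the past, because such a factor can be pulled out of the conditional expectation. The argument
  runs by coordinates since \<open>real_cond_exp\<close> is scalar.\<close>

lemma expectation_inner_noise:
  assumes k: "k < N" and X: "X \<in> borel_measurable (filt P N w n)" "sq_int P X"
  shows "integrable P (\<lambda>x. inner (X x) (s n k x))" "expectation (\<lambda>x. inner (X x) (s n k x)) = 0"
proof -
  interpret F: finite_measure_subalgebra P "filt P N w n"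
    by (rule finite_measure_subalgebra_filt)
  have int: "integrable P (\<lambda>x. X x $ j * s n k x $ j)" for j
    using X k by (intro sq_int_mult sq_int_nth sq_int_s)
  have zero: "expectation (\<lambda>x. X x $ j * s n k x $ j) = 0" for j
  proof -
    have [measurable]: "s n k \<in> borel_measurable P" using k s_meas by simp
    have "(\<lambda>x. X x $ j) \<in> borel_measurable (filt P N w n)"
      by (rule borel_measurable_continuous_on[OF _ X(1)]) (intro continuous_intros)
    moreover have "(\<lambda>x. s n k x $ j) \<in> borel_measurable P"
      using sq_int_nth[OF sq_int_s[OF k]] by (rule sq_int_measurable)
    ultimately have "expectation (\<lambda>x. X x $ j * s n k x $ j)
        = expectation (\<lambda>x. X x $ j * real_cond_exp P (filt P N w n) (\<lambda>y. s n k y $ j) x)"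
      using int by (intro F.real_cond_exp_intg(2)[symmetric]) auto
    also have "\<dots> = expectation (\<lambda>_. 0)"
    proof (rule integral_cong_AE)
      have "(\<lambda>x. X x $ j) \<in> borel_measurable P"
        using sq_int_nth[OF X(2)] by (simp add: sq_int_def)
      then show "(\<lambda>x. X x $ j * real_cond_exp P (filt P N w n) (\<lambda>y. s n k y $ j) x) \<in> borel_measurable P"
        by (intro borel_measurable_times borel_measurable_cond_exp2)
    qed (use s_mean[OF k, of n j] in auto)
    finally show ?thesis by simp
  qed
  show "integrable P (\<lambda>x. inner (X x) (s n k x))"
    unfolding inner_vec_def using int by auto
  show "expectation (\<lambda>x. inner (X x) (s n k x)) = 0"
    unfolding inner_vec_def using int zero by (simp add: Bochner_Integration.integral_sum)
qed

text \<open>Tower property of the nonnegative conditional expectation, tested against the constant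
  1; integrability allows the return from extended reals to \<open>expectation\<close>.\<close>

lemma expectation_noise_le:
  assumes k: "k < N"
  shows "expectation (\<lambda>x. (norm (s n k x))\<^sup>2) \<le> (\<beta> k)\<^sup>2 * mse k n + (\<sigma> k)\<^sup>2"
proof -
  interpret F: finite_measure_subalgebra P "filt P N w n"
    by (rule finite_measure_subalgebra_filt)
  have [measurable]: "s n k \<in> borel_measurable P" using k s_meas by simp
  have e: "integrable P (\<lambda>x. (norm (err n k x))\<^sup>2)" using sq_int_err[OF k] by (simp add: sq_int_def)
  have "ennreal (expectation (\<lambda>x. (norm (s n k x))\<^sup>2)) = (\<integral>\<^sup>+ x. ennreal ((norm (s n k x))\<^sup>2) \<partial>P)"
    using s_sq[OF k] by (intro nn_integral_eq_integral[symmetric]) auto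
  also have "\<dots> = (\<integral>\<^sup>+ x. nn_cond_exp P (filt P N w n) (\<lambda>y. ennreal ((norm (s n k y))\<^sup>2)) x \<partial>P)"
    using F.nn_cond_exp_intg[of "\<lambda>_. 1" "\<lambda>y. ennreal ((norm (s n k y))\<^sup>2)"] by simp
  also have "\<dots> \<le> (\<integral>\<^sup>+ x. ennreal ((\<beta> k)\<^sup>2 * (norm (err n k x))\<^sup>2 + (\<sigma> k)\<^sup>2) \<partial>P)"
    using s_var[OF k, of n] by (intro nn_integral_mono_AE) (simp add: err_def norm_minus_commute)
  also have "\<dots> = ennreal (expectation (\<lambda>x. (\<beta> k)\<^sup>2 * (norm (err n k x))\<^sup>2 + (\<sigma> k)\<^sup>2))"
    using e by (intro nn_integral_eq_integral) auto
  also have "expectation (\<lambda>x. (\<beta> k)\<^sup>2 * (norm (err n k x))\<^sup>2 + (\<sigma> k)\<^sup>2) = (\<beta> k)\<^sup>2 * mse k n + (\<sigma> k)\<^sup>2"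
    using e by (simp add: mse_def prob_space)
  finally show ?thesis using mse_nonneg[of k n] by (subst (asm) ennreal_le_iff) auto
qed

end

section \<open>Mean-square bound for one sub-network of group \<open>S\<close>\<close>

lemma (in perron_block) integrable_V:
  fixes X :: "nat \<Rightarrow> 'o \<Rightarrow> 'v::euclidean_space"
  assumes "finite_measure Q" "\<And>k. k \<in> I \<Longrightarrow> sq_int Q (X k)"
  shows "integrable Q (\<lambda>x. V (\<lambda>k. X k x))"
proof -
  interpret finite_measure Q by fact
  have "sq_int Q (\<lambda>x. (adj ^^ j) (\<lambda>k. X k x) k)" if "k \<in> I" for j k
    unfolding funpow_adj[OF that] using assms by (intro sq_int_sum sq_int_scaleR)
  then show ?thesis
    unfolding V_def psq_def
    by (auto intro!: Bochner_Integration.integrable_sum integrable_mult_right simp: sq_int_def)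
qed

text \<open>In expectation along a run, the cross term of \<open>Z_step\<close> vanishes and the
  noise energy is bounded affinely by the error, which leaves a scalar affine recursion for the mean
  of \<open>Z\<close>.\<close>

lemma block_mean_square_bound:
  fixes I :: "nat set" and g :: "nat \<Rightarrow> real^'M \<Rightarrow> real^'M"
  assumes block: "diffusion_block I a p m \<tau> g L \<nu> z"
    and I: "I \<subseteq> {..<N}" and closed: "\<And>l k. k \<in> I \<Longrightarrow> l < N \<Longrightarrow> l \<notin> I \<Longrightarrow> a l k = 0"
    and wstar: "\<And>k. k \<in> I \<Longrightarrow> wstar k = z"
  shows "\<exists>\<mu>0>0. \<exists>c\<ge>0. \<forall>\<mu>. 0 < \<mu> \<and> \<mu> < \<mu>0 \<longrightarrow>
    (\<forall>(P :: 'o measure) w s. diffusion_run P N a \<tau> \<beta> \<sigma> g wstar \<mu> w s \<longrightarrow>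
      (\<forall>\<^sub>F n in sequentially. \<forall>k\<in>I. diffusion_run.mse P wstar w k n \<le> c * \<mu>))"
proof -
  interpret diffusion_block I a p m \<tau> g L \<nu> z by fact
  obtain \<mu>1 K where \<mu>1: "0 < \<mu>1" and K: "0 \<le> K" and Z_step:
    "\<And>\<mu> e s. 0 < \<mu> \<Longrightarrow> \<mu> < \<mu>1 \<Longrightarrow>
       Z (step \<mu> e s) \<le> (1 - \<mu> * \<nu> / 2) * Z e + K * \<mu>\<^sup>2 * (1 + (\<Sum>l\<in>I. (norm (s l))\<^sup>2))
         - 2 * \<mu> * inner (avg e - \<mu> *\<^sub>R drift e) (noise s)"
    using Z_step by blast
  \<comment> \<open>Each \<beta> term involves the error of a single agent, which \<open>Z\<close>
    controls only up to division by its Perron weight.\<close>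
  define B where "B = (\<Sum>l\<in>I. (\<beta> l)\<^sup>2 / p l)"
  define S where "S = (\<Sum>l\<in>I. (\<sigma> l)\<^sup>2)"
  have B: "0 \<le> B" and S: "0 \<le> S"
    using p_pos by (auto simp: B_def S_def less_imp_le intro!: sum_nonneg divide_nonneg_nonneg)
  \<comment> \<open>The three bounds serve, in this order, \<open>Z_step\<close>, the sign of the
    contraction factor, and the absorption of the noise feedback \<mu>^2 * K * B into \<mu> * \<nu>
    / 4.\<close>
  define \<mu>0 where "\<mu>0 = min \<mu>1 (min (1 / \<nu>) (\<nu> / (4 * (K * B + 1))))"
  have KB: "0 < K * B + 1" using K B by (simp add: add_nonneg_pos)
  have \<mu>0: "0 < \<mu>0" using \<mu>1 nu_pos KB by (simp add: \<mu>0_def)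
  \<comment> \<open>A forcing K * (1 + S) * \<mu>^2 over a gap \<mu> * \<nu> / 4 gives the fixed
    point, a multiple of \<mu>; the added 1 is the strict slack.\<close>
  define b where "b = 4 * K * (1 + S) / \<nu> + 1"
  have b: "0 < b" using K S nu_pos by (simp add: b_def add_nonneg_pos)
  define c where "c = b * (\<Sum>k\<in>I. 1 / p k)"
  have c0: "0 \<le> c" using b p_pos by (auto simp: c_def less_imp_le intro!: mult_nonneg_nonneg sum_nonneg)
  have "\<forall>\<^sub>F n in sequentially. \<forall>k\<in>I. diffusion_run.mse P wstar w k n \<le> c * \<mu>"
    if \<mu>: "0 < \<mu>" "\<mu> < \<mu>0" and run: "diffusion_run P N a \<tau> \<beta> \<sigma> g wstar \<mu> w s"
    for \<mu> and P :: "'o measure" and w s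
  proof -
    interpret diffusion_run P N a \<tau> \<beta> \<sigma> g wstar \<mu> w s by fact
    define EZ where "EZ n = expectation (\<lambda>x. Z (\<lambda>k. err n k x))" for n
    have sq_err: "sq_int P (err n k)" if "k \<in> I" for n k using that I sq_int_err by blast
    have sq_avg: "sq_int P (\<lambda>x. avg (\<lambda>k. err n k x))" for n
      unfolding avg_def using sq_err by (intro sq_int_sum sq_int_scaleR)
    have int_Z: "integrable P (\<lambda>x. Z (\<lambda>k. err n k x))" for n
      unfolding Z_def using sq_avg sq_err
      by (intro Bochner_Integration.integrable_add integrable_V sq_int_diff)
        (auto simp: sq_int_def finite_measure_axioms)
    have EZ0: "0 \<le> EZ n" for n
      unfolding EZ_def by (intro Bochner_Integration.integral_nonneg) (simp add: Z_def V_nonneg)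
    have mse_le: "p k * mse k n \<le> EZ n" if "k \<in> I" for k n
    proof -
      have "p k * mse k n = expectation (\<lambda>x. p k * (norm (err n k x))\<^sup>2)" by (simp add: mse_def)
      also have "\<dots> \<le> EZ n"
        unfolding EZ_def using that sq_err int_Z
        by (intro integral_mono norm_le_Z) (auto simp: sq_int_def)
      finally show ?thesis .
    qed
    have err_Suc: "err (Suc n) k x = step \<mu> (\<lambda>l. err n l x) (\<lambda>l. s n l x) k"
      if k: "k \<in> I" and x: "x \<in> space P" for n k x
    proof -
      have "w (Suc n) k x = (\<Sum>l\<in>I. a l k *\<^sub>R (w n l x - (\<tau> l * \<mu>) *\<^sub>R (g l (w n l x) + s n l x)))"
        using k x I closed by (subst w_Suc) (auto intro!: sum.mono_neutral_right)
      moreover have "z = (\<Sum>l\<in>I. a l k *\<^sub>R z)"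
        using k by (simp add: scaleR_sum_left[symmetric] a_stoch)
      ultimately have "err (Suc n) k x
          = (\<Sum>l\<in>I. a l k *\<^sub>R (w n l x - (\<tau> l * \<mu>) *\<^sub>R (g l (w n l x) + s n l x)) - a l k *\<^sub>R z)"
        using k by (simp add: err_def wstar sum_subtractf)
      also have "\<dots> = step \<mu> (\<lambda>l. err n l x) (\<lambda>l. s n l x) k"
        unfolding step_def by (intro sum.cong refl) (simp add: err_def wstar algebra_simps)
      finally show ?thesis .
    qed
    have noise_le: "(\<Sum>l\<in>I. expectation (\<lambda>x. (norm (s n l x))\<^sup>2)) \<le> B * EZ n + S" for n
    proof -
      have "(\<Sum>l\<in>I. expectation (\<lambda>x. (norm (s n l x))\<^sup>2)) \<le> (\<Sum>l\<in>I. (\<beta> l)\<^sup>2 / p l * EZ n + (\<sigma> l)\<^sup>2)"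
      proof (rule sum_mono)
        fix l assume l: "l \<in> I"
        have "(\<beta> l)\<^sup>2 * mse l n = (\<beta> l)\<^sup>2 / p l * (p l * mse l n)"
          using p_pos[OF l] by simp
        also have "\<dots> \<le> (\<beta> l)\<^sup>2 / p l * EZ n"
          using p_pos[OF l] by (intro mult_left_mono mse_le[OF l]) auto
        finally show "expectation (\<lambda>x. (norm (s n l x))\<^sup>2) \<le> (\<beta> l)\<^sup>2 / p l * EZ n + (\<sigma> l)\<^sup>2"
          using expectation_noise_le[of l n] l I by auto
      qed
      then show ?thesis by (simp add: B_def S_def sum.distrib sum_distrib_right)
    qed
    have cross: "integrable P (\<lambda>x. inner (avg (\<lambda>k. err n k x) - \<mu> *\<^sub>R drift (\<lambda>k. err n k x)) (noise (\<lambda>k. s n k x)))"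
      "expectation (\<lambda>x. inner (avg (\<lambda>k. err n k x) - \<mu> *\<^sub>R drift (\<lambda>k. err n k x)) (noise (\<lambda>k. s n k x))) = 0" for n
    proof -
      define X where "X = (\<lambda>x. avg (\<lambda>k. err n k x) - \<mu> *\<^sub>R drift (\<lambda>k. err n k x))"
      have w_eq: "z + err n k x = w n k x" if "k \<in> I" for k x
        using that by (simp add: err_def wstar)
      \<comment> \<open>Written through the iterates, \<open>X\<close> is visibly determined by the
        past: the gradients enter as continuous functions of \<open>w n k\<close>.\<close>
      have X_eq: "X = (\<lambda>x. (\<Sum>k\<in>I. p k *\<^sub>R (w n k x - z)) - \<mu> *\<^sub>R (\<Sum>k\<in>I. (\<tau> k * p k) *\<^sub>R g k (w n k x)))"
        by (simp add: X_def avg_def drift_def fun_eq_iff w_eq cong: sum.cong)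
           (simp add: err_def wstar)
      have [measurable]: "w n k \<in> borel_measurable (filt P N w n)"
        "(\<lambda>x. g k (w n k x)) \<in> borel_measurable (filt P N w n)" if "k \<in> I" for k
        using that I w_filt_measurable[of k n]
          borel_measurable_continuous_on[OF g_continuous[of k] w_filt_measurable[of k n]] by auto
      have Xm: "X \<in> borel_measurable (filt P N w n)" unfolding X_eq by measurable
      have Xs: "sq_int P X" unfolding X_eq using I
        by (intro sq_int_diff sq_int_scaleR sq_int_sum sq_int_g sq_int_w sq_int_const) auto
      have inner_eq: "inner (X x) (noise (\<lambda>k. s n k x)) = (\<Sum>k\<in>I. (\<tau> k * p k) * inner (X x) (s n k x))" for x
        by (simp add: noise_def inner_sum_right)
      have n: "integrable P (\<lambda>x. inner (X x) (s n k x))" "expectation (\<lambda>x. inner (X x) (s n k x)) = 0"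
        if "k \<in> I" for k using expectation_inner_noise[OF _ Xm Xs, of k] that I by auto
      show "integrable P (\<lambda>x. inner (avg (\<lambda>k. err n k x) - \<mu> *\<^sub>R drift (\<lambda>k. err n k x)) (noise (\<lambda>k. s n k x)))"
        unfolding X_def[THEN fun_cong, symmetric] inner_eq using n
        by (intro Bochner_Integration.integrable_sum integrable_mult_right) auto
      show "expectation (\<lambda>x. inner (avg (\<lambda>k. err n k x) - \<mu> *\<^sub>R drift (\<lambda>k. err n k x)) (noise (\<lambda>k. s n k x))) = 0"
        unfolding X_def[THEN fun_cong, symmetric] inner_eq using n
        by (subst Bochner_Integration.integral_sum) auto
    qed
    have EZ_Suc: "EZ (Suc n) \<le> (1 - \<mu> * \<nu> / 4) * EZ n + K * (1 + S) * \<mu>\<^sup>2" for n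
    proof -
      have s_int: "integrable P (\<lambda>x. (norm (s n l x))\<^sup>2)" if "l \<in> I" for l
        using s_sq that I by auto
      let ?rhs = "\<lambda>x. (1 - \<mu> * \<nu> / 2) * Z (\<lambda>k. err n k x)
          + K * \<mu>\<^sup>2 * (1 + (\<Sum>l\<in>I. (norm (s n l x))\<^sup>2))
          - 2 * \<mu> * inner (avg (\<lambda>k. err n k x) - \<mu> *\<^sub>R drift (\<lambda>k. err n k x)) (noise (\<lambda>k. s n k x))"
      have "EZ (Suc n) \<le> expectation ?rhs"
        unfolding EZ_def
      proof (rule integral_mono)
        show "integrable P ?rhs" using int_Z cross s_int by auto
        fix x assume "x \<in> space P"
        then have "Z (\<lambda>k. err (Suc n) k x) = Z (step \<mu> (\<lambda>l. err n l x) (\<lambda>l. s n l x))"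
          by (intro Z_cong err_Suc)
        then show "Z (\<lambda>k. err (Suc n) k x) \<le> ?rhs x"
          using Z_step[of \<mu> "\<lambda>l. err n l x" "\<lambda>l. s n l x"] \<mu> by (simp add: \<mu>0_def)
      qed (rule int_Z)
      also have "\<dots> = (1 - \<mu> * \<nu> / 2) * EZ n
          + K * \<mu>\<^sup>2 * (1 + (\<Sum>l\<in>I. expectation (\<lambda>x. (norm (s n l x))\<^sup>2)))"
        using int_Z cross s_int by (simp add: EZ_def prob_space)
      also have "\<dots> \<le> (1 - \<mu> * \<nu> / 2) * EZ n + K * \<mu>\<^sup>2 * (1 + (B * EZ n + S))"
        using noise_le[of n] K by (intro add_left_mono mult_left_mono) auto
      also have "\<dots> = (1 - \<mu> * \<nu> / 2 + \<mu> * (\<mu> * (K * B))) * EZ n + K * (1 + S) * \<mu>\<^sup>2"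
        by (simp add: algebra_simps power2_eq_square)
      also have "1 - \<mu> * \<nu> / 2 + \<mu> * (\<mu> * (K * B)) \<le> 1 - \<mu> * \<nu> / 4"
      proof -
        have "\<mu> * (4 * (K * B + 1)) \<le> \<nu>"
          using \<mu> KB by (simp add: \<mu>0_def less_divide_eq)
        then have "\<mu> * (K * B) \<le> \<nu> / 4" using \<mu> by (simp add: algebra_simps)
        then have "\<mu> * (\<mu> * (K * B)) \<le> \<mu> * (\<nu> / 4)" using \<mu> by (intro mult_left_mono) auto
        then show ?thesis by simp
      qed
      finally show ?thesis using EZ0[of n] by (simp add: mult_right_mono)
    qed
    have "\<mu> * \<nu> < 1" using \<mu> nu_pos by (simp add: \<mu>0_def less_divide_eq)
    then have q: "0 \<le> 1 - \<mu> * \<nu> / 4" "1 - \<mu> * \<nu> / 4 < 1" using \<mu> nu_pos by auto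
    have "K * (1 + S) * \<mu>\<^sup>2 / (1 - (1 - \<mu> * \<nu> / 4)) = (b - 1) * \<mu>"
      using \<mu> nu_pos by (simp add: b_def field_simps power2_eq_square)
    also have "\<dots> < b * \<mu>" using \<mu> by simp
    finally have "\<forall>\<^sub>F n in sequentially. EZ n \<le> b * \<mu>"
      using EZ_Suc by (intro eventually_le_of_affine_recursion[OF q, of EZ]) auto
    then show "\<forall>\<^sub>F n in sequentially. \<forall>k\<in>I. mse k n \<le> c * \<mu>"
    proof eventually_elim
      case (elim n)
      show ?case
      proof
        fix k assume k: "k \<in> I"
        have "mse k n \<le> EZ n * (1 / p k)" using mse_le[OF k, of n] p_pos[OF k] by (simp add: field_simps)
        also have "\<dots> \<le> (b * \<mu>) * (\<Sum>k\<in>I. 1 / p k)"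
          using elim k finite_I p_pos EZ0[of n] b \<mu>
          by (intro mult_mono member_le_sum[of k I "\<lambda>k. 1 / p k"]) (auto simp: less_imp_le)
        finally show "mse k n \<le> c * \<mu>" by (simp add: c_def mult_ac)
      qed
    qed
  qed
  then show ?thesis
    using \<mu>0 c0 by (intro exI[of _ \<mu>0] exI[of _ c] conjI allI impI) auto
qed

section \<open>Gradients of convex functions\<close>

text \<open>Restriction to the line through \<open>x\<close> and \<open>y\<close> reduces this to
  the tangent inequality in one variable.\<close>

lemma convex_gradient_below:
  fixes f :: "'v::real_inner \<Rightarrow> real"
  assumes cvx: "convex_on UNIV f" and f: "(f has_derivative (\<lambda>h. inner (g x) h)) (at x)"
  shows "f x + inner (g x) (y - x) \<le> f y"
proof -
  define \<phi> where "\<phi> t = f (x + t *\<^sub>R (y - x))" for t :: real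
  have "convex_on UNIV \<phi>"
  proof (rule convex_onI)
    fix t u v :: real assume t: "0 < t" "t < 1"
    have "\<phi> ((1 - t) *\<^sub>R u + t *\<^sub>R v) = f ((1 - t) *\<^sub>R (x + u *\<^sub>R (y - x)) + t *\<^sub>R (x + v *\<^sub>R (y - x)))"
      by (simp add: \<phi>_def algebra_simps)
    also have "\<dots> \<le> (1 - t) * \<phi> u + t * \<phi> v"
      unfolding \<phi>_def using t by (intro convex_onD[OF cvx]) auto
    finally show "\<phi> ((1 - t) *\<^sub>R u + t *\<^sub>R v) \<le> (1 - t) * \<phi> u + t * \<phi> v" .
  qed simp
  moreover have "(\<phi> has_field_derivative inner (g x) (y - x)) (at 0)"
  proof -
    have "(\<phi> has_derivative (\<lambda>t. inner (g x) (t *\<^sub>R (y - x)))) (at 0)"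
      unfolding \<phi>_def
      by (rule has_derivative_compose[where f = "\<lambda>t. x + t *\<^sub>R (y - x)" and g = f])
         (use f in \<open>auto intro!: derivative_eq_intros\<close>)
    moreover have "(\<lambda>t. inner (g x) (t *\<^sub>R (y - x))) = (*) (inner (g x) (y - x))"
      by (simp add: fun_eq_iff mult.commute)
    ultimately show ?thesis by (simp add: has_field_derivative_def)
  qed
  ultimately have "\<phi> 1 - \<phi> 0 \<ge> inner (g x) (y - x) * (1 - 0)"
    by (intro convex_on_imp_above_tangent[of UNIV]) auto
  then show ?thesis by (simp add: \<phi>_def)
qed

text \<open>Sum of the tangent inequalities at \<open>x\<close> and at \<open>y\<close>.\<close>

lemma convex_gradient_mono:
  fixes f :: "'v::real_inner \<Rightarrow> real"
  assumes "convex_on UNIV f" and "\<And>x. (f has_derivative (\<lambda>h. inner (g x) h)) (at x)"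
  shows "0 \<le> inner (x - y) (g x - g y)"
  using convex_gradient_below[OF assms, where x = x and y = y]
    convex_gradient_below[OF assms, where x = y and y = x]
  by (simp add: inner_diff inner_commute)

text \<open>Subtracting the quadratic leaves a convex function with gradient g x - \<nu> x; its
  monotonicity rearranges to the claim.\<close>

lemma strongly_convex_gradient_mono:
  fixes f :: "'v::real_inner \<Rightarrow> real"
  assumes "strongly_convex_on UNIV f" and f: "\<And>x. (f has_derivative (\<lambda>h. inner (g x) h)) (at x)"
  obtains \<nu> where "0 < \<nu>" "\<And>x y. \<nu> * (norm (x - y))\<^sup>2 \<le> inner (x - y) (g x - g y)"
proof -
  obtain \<nu> where \<nu>: "0 < \<nu>" and cvx: "convex_on UNIV (\<lambda>w. f w - (\<nu> / 2) * (norm w)\<^sup>2)"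
    using assms(1) by (auto simp: strongly_convex_on_def)
  have "((\<lambda>w. f w - (\<nu> / 2) * (norm w)\<^sup>2) has_derivative (\<lambda>h. inner (g x - \<nu> *\<^sub>R x) h)) (at x)" for x
    unfolding power2_norm_eq_inner
    by (rule derivative_eq_intros f | rule refl)+
       (simp add: fun_eq_iff inner_diff inner_commute algebra_simps)
  from convex_gradient_mono[OF cvx this] have
    "0 \<le> inner (x - y) ((g x - \<nu> *\<^sub>R x) - (g y - \<nu> *\<^sub>R y))" for x y .
  moreover have "(g x - \<nu> *\<^sub>R x) - (g y - \<nu> *\<^sub>R y) = (g x - g y) - \<nu> *\<^sub>R (x - y)" for x y
    by (simp add: algebra_simps)
  ultimately have "0 \<le> inner (x - y) ((g x - g y) - \<nu> *\<^sub>R (x - y))" for x y by metis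
  then have "\<nu> * (norm (x - y))\<^sup>2 \<le> inner (x - y) (g x - g y)" for x y
    unfolding inner_diff_right[of _ "g _ - g _"] by (simp add: power2_norm_eq_inner)
  with \<nu> show thesis using that by blast
qed

section \<open>The receiving sub-networks\<close>

text \<open>\<open>deficient\<close> sums a column over its own block only: the missing mass may
  come from outside \<open>K\<close> or from another block in \<open>K\<close>, which by
  \<open>a_upper\<close> has a smaller number.\<close>

locale receiving_group =
  fixes K :: "nat set" and a :: "nat \<Rightarrow> nat \<Rightarrow> real" and sn :: "nat \<Rightarrow> nat"
  assumes finite_K: "finite K"
    and a_nonneg: "\<And>l k. l \<in> K \<Longrightarrow> k \<in> K \<Longrightarrow> 0 \<le> a l k"
    and a_substoch: "\<And>k. k \<in> K \<Longrightarrow> (\<Sum>l\<in>K. a l k) \<le> 1"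
    and a_upper: "\<And>l k. l \<in> K \<Longrightarrow> k \<in> K \<Longrightarrow> sn k < sn l \<Longrightarrow> a l k = 0"
    and irred: "\<And>k. k \<in> K \<Longrightarrow> irreducible_sub {l \<in> K. sn l = sn k} a"
    and deficient: "\<And>k. k \<in> K \<Longrightarrow> \<exists>j\<in>K. sn j = sn k \<and> (\<Sum>l | l \<in> K \<and> sn l = sn k. a l j) < 1"
begin

text \<open>A maximum principle: the indices at which a harmonic vector has maximal modulus are closed
  under predecessors. Taking one in the lowest sub-network, irreducibility spreads the maximum over
  that sub-network, and its deficient column then has a predecessor in a still lower one.\<close>

lemma harmonic_eq_0:
  assumes x: "\<And>k. k \<in> K \<Longrightarrow> x k = (\<Sum>l\<in>K. a l k * x l)" and k: "k \<in> K"
  shows "x k = 0"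
proof (rule ccontr)
  assume xk: "x k \<noteq> 0"
  define M where "M = Max ((\<lambda>k. \<bar>x k\<bar>) ` K)"
  have le_M: "\<bar>x l\<bar> \<le> M" if "l \<in> K" for l using that finite_K by (simp add: M_def)
  have M: "0 < M" using le_M[OF k] xk by linarith
  define T where "T = {k \<in> K. \<bar>x k\<bar> = M}"
  have "M \<in> (\<lambda>k. \<bar>x k\<bar>) ` K" unfolding M_def using finite_K k by (intro Max_in) auto
  then have "T \<noteq> {}" by (auto simp: T_def)
  \<comment> \<open>Equality case of the triangle estimate: a subconvex combination of values of
    modulus at most \<open>M\<close> reaches \<open>M\<close> only with full mass, and then only
    from indices in \<open>T\<close>.\<close>
  have tight: "(\<Sum>l\<in>K. a l j) = 1 \<and> (\<forall>l\<in>K. a l j > 0 \<longrightarrow> l \<in> T)" if j: "j \<in> T" for j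
  proof -
    have jK: "j \<in> K" using j by (simp add: T_def)
    have "M = \<bar>\<Sum>l\<in>K. a l j * x l\<bar>" using j x by (auto simp: T_def)
    also have "\<dots> \<le> (\<Sum>l\<in>K. a l j * \<bar>x l\<bar>)"
      using a_nonneg jK by (intro order_trans[OF sum_abs] sum_mono) (simp add: abs_mult)
    finally have 1: "M \<le> (\<Sum>l\<in>K. a l j * \<bar>x l\<bar>)" .
    have nn: "0 \<le> a l j * (M - \<bar>x l\<bar>)" if "l \<in> K" for l
      using a_nonneg[OF that jK] le_M[OF that] by simp
    have eq: "(\<Sum>l\<in>K. a l j * (M - \<bar>x l\<bar>)) = (\<Sum>l\<in>K. a l j) * M - (\<Sum>l\<in>K. a l j * \<bar>x l\<bar>)"
      by (simp add: right_diff_distrib sum_subtractf sum_distrib_right)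
    have "(\<Sum>l\<in>K. a l j) * M \<le> 1 * M" using a_substoch[OF jK] M by (intro mult_right_mono) auto
    moreover have "0 \<le> (\<Sum>l\<in>K. a l j * (M - \<bar>x l\<bar>))" using nn by (rule sum_nonneg)
    ultimately have sum0: "(\<Sum>l\<in>K. a l j * (M - \<bar>x l\<bar>)) = 0" and "(\<Sum>l\<in>K. a l j) * M = M"
      using 1 eq by linarith+
    then have "(\<Sum>l\<in>K. a l j) = 1" using M by simp
    moreover have "l \<in> T" if "l \<in> K" "a l j > 0" for l
    proof -
      have "a l j * (M - \<bar>x l\<bar>) = 0"
        using sum0 nn that finite_K by (subst (asm) sum_nonneg_eq_0_iff) auto
      then show ?thesis using that by (simp add: T_def)
    qed
    ultimately show ?thesis by blast
  qed
  obtain j where j: "j \<in> T" and j_min: "\<And>i. i \<in> T \<Longrightarrow> sn j \<le> sn i"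
    using ex_min_if_finite[of "sn ` T"] \<open>T \<noteq> {}\<close> finite_K
    by (metis (no_types, lifting) arg_min_if_finite(1) arg_min_least finite_subset T_def mem_Collect_eq subsetI)
  have jK: "j \<in> K" using j by (simp add: T_def)
  define B where "B = {l \<in> K. sn l = sn j}"
  have B_nonneg: "\<And>i l. i \<in> B \<Longrightarrow> l \<in> B \<Longrightarrow> 0 \<le> a i l" using a_nonneg by (auto simp: B_def)
  \<comment> \<open>A positive entry of the power is a path of positive weights inside the block; it
    is followed backwards from its end \<open>l\<close>, each induction step removing the last
    edge.\<close>
  have spread: "i \<in> T" if "i \<in> B" "l \<in> B" "l \<in> T" "sub_mat_pow B a n i l > 0" for i l n
    using that(2-)
  proof (induction n arbitrary: l)
    case 0
    then show ?case by (auto split: if_splits)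
  next
    case (Suc n)
    from Suc.prems(3) obtain v where v: "v \<in> B" "sub_mat_pow B a n i v * a v l > 0"
      by (auto simp: less_le_not_le[of 0 "sum _ _"]) (meson not_less sum_nonpos)
    have "0 \<le> sub_mat_pow B a n i v" using sub_mat_pow_nonneg[OF B_nonneg \<open>i \<in> B\<close> v(1)] .
    then have pos: "sub_mat_pow B a n i v > 0" "a v l > 0"
      using v(2) by (auto simp: zero_less_mult_iff)
    have "v \<in> T" using tight[OF Suc.prems(2)] pos v by (auto simp: B_def)
    then show ?case using Suc.IH v pos by blast
  qed
  have BT: "B \<subseteq> T"
  proof
    fix i assume i: "i \<in> B"
    have jB: "j \<in> B" using jK by (simp add: B_def)
    obtain n where "sub_mat_pow B a n i j > 0"
      using irred[OF jK] i jB unfolding irreducible_sub_def B_def by blast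
    then show "i \<in> T" using spread[OF i jB j] by blast
  qed
  obtain d where d: "d \<in> K" "sn d = sn j" "(\<Sum>l\<in>B. a l d) < 1"
    using deficient[OF jK] by (auto simp: B_def)
  then have "d \<in> T" using BT by (auto simp: B_def)
  have "(\<Sum>l\<in>K. a l d) = (\<Sum>l\<in>B. a l d) + (\<Sum>l\<in>K - B. a l d)"
    using sum.subset_diff[of B K "\<lambda>l. a l d"] finite_K by (simp add: B_def add.commute)
  \<comment> \<open>By \<open>tight\<close> the column of \<open>d\<close> has full mass over
    \<open>K\<close>, while its own block supplies less than 1; the rest comes from outside the
    block.\<close>
  then have "0 < (\<Sum>l\<in>K - B. a l d)" using d tight[OF \<open>d \<in> T\<close>] by simp
  then obtain l where l: "l \<in> K - B" "0 < a l d" by (meson not_less sum_nonpos)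
  then have "l \<in> T" using tight[OF \<open>d \<in> T\<close>] by blast
  then have "sn j \<le> sn l" by (rule j_min)
  moreover have "sn l \<le> sn j" using a_upper[of l d] l d by (force simp: not_less[symmetric])
  ultimately show False using l by (auto simp: B_def)
qed

end

section \<open>Resolvent of the receiving group and the weights derived from it\<close>

text \<open>Minimum principle: a negative minimum \<iota> would satisfy \<iota> \<ge> 1 + \<iota>
  where it is attained. Once \<open>h\<close> is nonnegative, the equation itself gives the
  bound.\<close>

lemma ge_1_if_eq_1_plus:
  fixes h :: "'i \<Rightarrow> real"
  assumes fin: "finite K" and a: "\<And>l k. l \<in> K \<Longrightarrow> k \<in> K \<Longrightarrow> 0 \<le> a l k"
    and sub: "\<And>k. k \<in> K \<Longrightarrow> (\<Sum>l\<in>K. a l k) \<le> 1"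
    and h: "\<And>k. k \<in> K \<Longrightarrow> h k = 1 + (\<Sum>l\<in>K. a l k * h l)" and k: "k \<in> K"
  shows "1 \<le> h k"
proof -
  define \<iota> where "\<iota> = Min (h ` K)"
  have le: "\<iota> \<le> h l" if "l \<in> K" for l using that fin by (simp add: \<iota>_def)
  have "\<iota> \<in> h ` K" unfolding \<iota>_def using fin k by (intro Min_in) auto
  then obtain i where i: "i \<in> K" "h i = \<iota>" by auto
  have "0 \<le> \<iota>"
  proof (rule ccontr)
    assume neg: "\<not> 0 \<le> \<iota>"
    have "1 * \<iota> \<le> (\<Sum>l\<in>K. a l i) * \<iota>" using sub[OF i(1)] neg by (intro mult_right_mono_neg) auto
    also have "\<dots> \<le> (\<Sum>l\<in>K. a l i * h l)"
      unfolding sum_distrib_right using a i le by (intro sum_mono mult_left_mono) auto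
    finally show False using h[OF i(1)] i by simp
  qed
  then have "0 \<le> (\<Sum>l\<in>K. a l k * h l)" using a k le by (intro sum_nonneg mult_nonneg_nonneg) (auto intro: order_trans)
  then show ?thesis using h[OF k] by simp
qed

text \<open>The kernel condition is put on the transpose because the maximum principle sums along
  columns. The result makes \<open>the (mat_inverse D)\<close> a genuine inverse instead of an
  unspecified value.\<close>

lemma mat_inverse_eq_Some:
  fixes D :: "real mat"
  assumes D: "D \<in> carrier_mat n n"
    and ker: "\<And>v. v \<in> carrier_vec n \<Longrightarrow> transpose_mat D *\<^sub>v v = 0\<^sub>v n \<Longrightarrow> v = 0\<^sub>v n"
  obtains Y where "mat_inverse D = Some Y" "Y \<in> carrier_mat n n" "Y * D = 1\<^sub>m n"
proof -
  have "det (transpose_mat D) \<noteq> 0"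
    using det_0_iff_vec_prod_zero[of "transpose_mat D" n] D ker by auto
  then have "D \<in> Units (ring_mat TYPE(real) n ())"
    using D by (intro det_non_zero_imp_unit) (simp_all add: det_transpose)
  then obtain Y where "mat_inverse D = Some Y" using mat_inverse(1)[OF D, of "()"] by (cases "mat_inverse D") auto
  then show thesis using mat_inverse(2)[OF D] that by blast
qed

text \<open>Entrywise form of Y = I + Y T, that is Y (I - T) = I. The left inverse is the useful
  side, as \<open>Y\<close> is the right factor of \<open>W_mat\<close>. Matrix index
  \<open>i\<close> stands for agent NgS + i.\<close>

lemma T_RR_resolvent:
  fixes Y
  assumes N: "NgS \<le> N" and grp: "receiving_group {NgS..<N} a sn"
  defines "Y \<equiv> the (mat_inverse (1\<^sub>m (N - NgS) - T_RR N NgS a))"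
  shows "Y \<in> carrier_mat (N - NgS) (N - NgS)"
    and "\<And>i j. i < N - NgS \<Longrightarrow> j < N - NgS \<Longrightarrow>
      Y $$ (i, j) = (if i = j then 1 else 0) + (\<Sum>q<N - NgS. Y $$ (i, q) * a (NgS + q) (NgS + j))"
proof -
  interpret receiving_group "{NgS..<N}" a sn by fact
  define n where "n = N - NgS"
  define D where "D = 1\<^sub>m n - T_RR N NgS a"
  have "T_RR N NgS a \<in> carrier_mat n n" by (simp add: T_RR_def n_def)
  then have D: "D \<in> carrier_mat n n" unfolding D_def by (rule minus_carrier_mat)
  have D_index: "D $$ (i, j) = (if i = j then 1 else 0) - a (NgS + i) (NgS + j)" if "i < n" "j < n" for i j
    using that by (simp add: D_def T_RR_def n_def)
  have shift: "(\<Sum>l\<in>{NgS..<N}. f l) = (\<Sum>i<n. f (NgS + i))" for f :: "nat \<Rightarrow> real"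
    by (rule sum.reindex_bij_witness[of _ "\<lambda>i. NgS + i" "\<lambda>l. l - NgS"]) (auto simp: n_def)
  have delta: "(\<Sum>i<n. (if i = j then 1 else 0) * f i) = f j" if "j < n" for j and f :: "nat \<Rightarrow> real"
  proof -
    have "(\<Sum>i<n. (if i = j then 1 else 0) * f i) = (\<Sum>i<n. if i = j then f i else 0)"
      by (intro sum.cong) auto
    then show ?thesis using that by simp
  qed
  have ker: "v = 0\<^sub>v n" if v: "v \<in> carrier_vec n" and 0: "transpose_mat D *\<^sub>v v = 0\<^sub>v n" for v
  proof -
    define x where "x k = vec_index v (k - NgS)" for k
    have "vec_index v j = (\<Sum>i<n. a (NgS + i) (NgS + j) * vec_index v i)" if j: "j < n" for j
    proof -
      have "0 = vec_index (transpose_mat D *\<^sub>v v) j" using 0 j by simp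
      also have "\<dots> = (\<Sum>i<n. D $$ (i, j) * vec_index v i)"
        using D v j by (simp add: scalar_prod_def atLeast0LessThan)
      also have "\<dots> = (\<Sum>i<n. (if i = j then 1 else 0) * vec_index v i)
          - (\<Sum>i<n. a (NgS + i) (NgS + j) * vec_index v i)"
        unfolding sum_subtractf[symmetric]
        using j by (intro sum.cong) (auto simp: D_index left_diff_distrib)
      finally show ?thesis using delta[OF j, of "vec_index v"] by simp
    qed
    then have "x k = (\<Sum>l\<in>{NgS..<N}. a l k * x l)" if "k \<in> {NgS..<N}" for k
      using that unfolding shift by (auto simp: x_def n_def dest!: spec[of _ "k - NgS"])
    then have "x k = 0" if "k \<in> {NgS..<N}" for k using harmonic_eq_0 that by blast
    then show ?thesis
      using v by (intro eq_vecI) (force simp: x_def n_def dest: spec[of _ "NgS + _"])+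
  qed
  obtain Y' where Y': "mat_inverse D = Some Y'" "Y' \<in> carrier_mat n n" "Y' * D = 1\<^sub>m n"
    using mat_inverse_eq_Some[OF D ker] by blast
  have Y_eq: "Y = Y'" using Y'(1) by (simp add: Y_def D_def n_def)
  show "Y \<in> carrier_mat (N - NgS) (N - NgS)" using Y' by (simp add: Y_eq n_def)
  fix i j assume "i < N - NgS" "j < N - NgS"
  then have ij: "i < n" "j < n" by (auto simp: n_def)
  have "(if i = j then 1 else 0) = (Y * D) $$ (i, j)" using Y' ij by (simp add: Y_eq)
  also have "\<dots> = (\<Sum>q<n. Y $$ (i, q) * D $$ (q, j))"
    using Y'(2) D ij by (simp add: Y_eq scalar_prod_def atLeast0LessThan)
  also have "\<dots> = (\<Sum>q<n. (if q = j then 1 else 0) * Y $$ (i, q))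
      - (\<Sum>q<n. Y $$ (i, q) * a (NgS + q) (NgS + j))"
    unfolding sum_subtractf[symmetric]
    using ij by (intro sum.cong) (auto simp: D_index right_diff_distrib)
  finally show "Y $$ (i, j) = (if i = j then 1 else 0) + (\<Sum>q<N - NgS. Y $$ (i, q) * a (NgS + q) (NgS + j))"
    using delta[OF ij(2), of "\<lambda>q. Y $$ (i, q)"] by (simp add: n_def)
qed

text \<open>Column sums of the resolvent, by Y = I + Y T. The weight \<open>h k\<close> is the
  expected number of visits to the group before the first exit, start included, of the walk from
  \<open>k\<close> that moves to \<open>l\<close> with probability \<open>a l k\<close>.\<close>

lemma receiving_weights:
  assumes N: "NgS \<le> N" and grp: "receiving_group {NgS..<N} a sn"
  obtains h where "\<And>k. k \<in> {NgS..<N} \<Longrightarrow> h k = 1 + (\<Sum>l\<in>{NgS..<N}. a l k * h l)"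
    "\<And>k. k \<in> {NgS..<N} \<Longrightarrow> 1 \<le> h k"
proof -
  interpret receiving_group "{NgS..<N}" a sn by fact
  define n where "n = N - NgS"
  define Y where "Y = the (mat_inverse (1\<^sub>m (N - NgS) - T_RR N NgS a))"
  define h where "h k = (\<Sum>i<n. Y $$ (i, k - NgS))" for k
  have eq: "h k = 1 + (\<Sum>l\<in>{NgS..<N}. a l k * h l)" if k: "k \<in> {NgS..<N}" for k
  proof -
    have kn: "k - NgS < n" using k by (auto simp: n_def)
    have "h k = (\<Sum>i<n. (if i = k - NgS then 1 else 0) + (\<Sum>q<n. Y $$ (i, q) * a (NgS + q) k))"
      unfolding h_def using T_RR_resolvent(2)[OF N grp, of _ "k - NgS"] kn k
      by (intro sum.cong) (auto simp: n_def Y_def)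
    also have "\<dots> = 1 + (\<Sum>i<n. \<Sum>q<n. Y $$ (i, q) * a (NgS + q) k)"
      unfolding sum.distrib using kn by simp
    also have "(\<Sum>i<n. \<Sum>q<n. Y $$ (i, q) * a (NgS + q) k) = (\<Sum>q<n. a (NgS + q) k * h (NgS + q))"
      by (subst sum.swap) (simp add: h_def sum_distrib_left mult.commute)
    also have "(\<Sum>q<n. a (NgS + q) k * h (NgS + q)) = (\<Sum>l\<in>{NgS..<N}. a l k * h l)"
      by (rule sum.reindex_bij_witness[of _ "\<lambda>l. l - NgS" "\<lambda>q. NgS + q"]) (auto simp: n_def)
    finally show ?thesis .
  qed
  moreover have "1 \<le> h k" if "k \<in> {NgS..<N}" for k
    using ge_1_if_eq_1_plus[of "{NgS..<N}" a h k] a_nonneg a_substoch eq that by auto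
  ultimately show thesis using that by blast
qed

text \<open>From W = T_SR Y and Y = I + Y T follows W = T_SR + W T; column by column this is the
  fixed point equation behind the limit points of group \<open>R\<close>.\<close>

lemma W_mat_eq:
  assumes N: "NgS \<le> N" and grp: "receiving_group {NgS..<N} a sn"
    and l: "l < NgS" and k: "k \<in> {NgS..<N}"
  shows "W_mat N NgS a $$ (l, k - NgS) = a l k + (\<Sum>i\<in>{NgS..<N}. a i k * W_mat N NgS a $$ (l, i - NgS))"
proof -
  define n where "n = N - NgS"
  define Y where "Y = the (mat_inverse (1\<^sub>m (N - NgS) - T_RR N NgS a))"
  have Y: "Y \<in> carrier_mat n n" using T_RR_resolvent(1)[OF N grp] by (simp add: Y_def n_def)
  have W: "W_mat N NgS a $$ (l, j) = (\<Sum>i<n. a l (NgS + i) * Y $$ (i, j))" if "j < n" for j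
    using that l Y by (simp add: W_mat_def Y_def[symmetric] T_SR_def scalar_prod_def atLeast0LessThan n_def)
  have kn: "k - NgS < n" using k by (auto simp: n_def)
  have "W_mat N NgS a $$ (l, k - NgS)
      = (\<Sum>i<n. a l (NgS + i) * ((if i = k - NgS then 1 else 0) + (\<Sum>q<n. Y $$ (i, q) * a (NgS + q) k)))"
    unfolding W[OF kn] using T_RR_resolvent(2)[OF N grp, of _ "k - NgS"] kn k
    by (intro sum.cong) (auto simp: n_def Y_def)
  also have "\<dots> = (\<Sum>i<n. if i = k - NgS then a l (NgS + i) else 0)
      + (\<Sum>i<n. \<Sum>q<n. a l (NgS + i) * (Y $$ (i, q) * a (NgS + q) k))"
    unfolding sum.distrib[symmetric] by (intro sum.cong) (auto simp: distrib_left sum_distrib_left)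
  also have "\<dots> = a l k + (\<Sum>q<n. a (NgS + q) k * W_mat N NgS a $$ (l, q))"
    using kn k by (subst sum.swap) (simp add: W sum_distrib_left mult_ac)
  also have "(\<Sum>q<n. a (NgS + q) k * W_mat N NgS a $$ (l, q)) = (\<Sum>i\<in>{NgS..<N}. a i k * W_mat N NgS a $$ (l, i - NgS))"
    by (rule sum.reindex_bij_witness[of _ "\<lambda>l. l - NgS" "\<lambda>q. NgS + q"]) (auto simp: n_def)
  finally show ?thesis .
qed

section \<open>Mean-square bound for the receiving group\<close>

text \<open>The gradient is split at \<open>wstar l\<close>, where it need not vanish; the 1 added
  to \<open>mse\<close> carries the terms that do not decay with the error.\<close>

lemma (in diffusion_run) expectation_drive_le:
  assumes l: "l < N" and tau: "0 < \<tau> l" "\<tau> l \<le> 1"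
    and lip: "\<And>x y. norm (g l x - g l y) \<le> L * norm (x - y)"
  shows "expectation (\<lambda>x. (norm (\<tau> l *\<^sub>R (g l (w n l x) + s n l x)))\<^sup>2)
     \<le> (4 * L\<^sup>2 + 4 * (norm (g l (wstar l)))\<^sup>2 + 2 * (\<beta> l)\<^sup>2 + 2 * (\<sigma> l)\<^sup>2) * (mse l n + 1)"
proof -
  have sq: "sq_int P (\<lambda>x. \<tau> l *\<^sub>R (g l (w n l x) + s n l x))"
    using l by (intro sq_int_scaleR sq_int_add sq_int_g sq_int_w sq_int_s)
  have e: "integrable P (\<lambda>x. (norm (err n l x))\<^sup>2)" "integrable P (\<lambda>x. (norm (s n l x))\<^sup>2)"
    using sq_int_err[OF l, of n] sq_int_s[OF l, of n] by (simp_all add: sq_int_def)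
  have "expectation (\<lambda>x. (norm (\<tau> l *\<^sub>R (g l (w n l x) + s n l x)))\<^sup>2)
      \<le> expectation (\<lambda>x. 4 * L\<^sup>2 * (norm (err n l x))\<^sup>2 + 4 * (norm (g l (wstar l)))\<^sup>2 + 2 * (norm (s n l x))\<^sup>2)"
  proof (rule integral_mono)
    fix x
    have "(norm (\<tau> l *\<^sub>R (g l (w n l x) + s n l x)))\<^sup>2 \<le> (norm (g l (w n l x) + s n l x))\<^sup>2"
      using tau by (intro power_mono) (auto simp: mult_left_le_one_le)
    also have "\<dots> \<le> 2 * (norm (g l (w n l x)))\<^sup>2 + 2 * (norm (s n l x))\<^sup>2" by (rule norm_add_power2_le2)
    also have "(norm (g l (w n l x)))\<^sup>2 \<le> 2 * (norm (g l (w n l x) - g l (wstar l)))\<^sup>2 + 2 * (norm (g l (wstar l)))\<^sup>2"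
      using norm_add_power2_le2[of "g l (w n l x) - g l (wstar l)" "g l (wstar l)"] by simp
    also have "(norm (g l (w n l x) - g l (wstar l)))\<^sup>2 \<le> L\<^sup>2 * (norm (err n l x))\<^sup>2"
      using power_mono[OF lip[of "w n l x" "wstar l"], of 2] by (simp add: power_mult_distrib err_def)
    finally show "(norm (\<tau> l *\<^sub>R (g l (w n l x) + s n l x)))\<^sup>2
      \<le> 4 * L\<^sup>2 * (norm (err n l x))\<^sup>2 + 4 * (norm (g l (wstar l)))\<^sup>2 + 2 * (norm (s n l x))\<^sup>2" by simp
  qed (use sq e in \<open>auto simp: sq_int_def\<close>)
  also have "\<dots> = 4 * L\<^sup>2 * mse l n + 4 * (norm (g l (wstar l)))\<^sup>2 + 2 * expectation (\<lambda>x. (norm (s n l x))\<^sup>2)"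
    using e by (simp add: mse_def prob_space)
  also have "\<dots> \<le> 4 * L\<^sup>2 * mse l n + 4 * (norm (g l (wstar l)))\<^sup>2 + 2 * ((\<beta> l)\<^sup>2 * mse l n + (\<sigma> l)\<^sup>2)"
    using expectation_noise_le[OF l, of n] by simp
  also have "\<dots> \<le> (4 * L\<^sup>2 + 4 * (norm (g l (wstar l)))\<^sup>2 + 2 * (\<beta> l)\<^sup>2 + 2 * (\<sigma> l)\<^sup>2) * (mse l n + 1)"
    using mse_nonneg[of l n] by (simp add: algebra_simps)
  finally show ?thesis .
qed

text \<open>The weights h make the transposed internal matrix a contraction of the weighted maximum
  norm with factor at most 1 - 1/H, and everything entering from outside K or through the step size
  acts as a forcing term of order \<mu>.\<close>

lemma receiving_mean_square_bound:
  fixes K :: "nat set" and g :: "nat \<Rightarrow> real^'M \<Rightarrow> real^'M"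
  assumes K: "K \<subseteq> {..<N}" and a: "\<And>l k. l < N \<Longrightarrow> k < N \<Longrightarrow> 0 \<le> a l k"
    and stoch: "\<And>k. k < N \<Longrightarrow> (\<Sum>l<N. a l k) = 1"
    and h: "\<And>k. k \<in> K \<Longrightarrow> h k = 1 + (\<Sum>l\<in>K. a l k * h l)" and h1: "\<And>k. k \<in> K \<Longrightarrow> 1 \<le> h k"
    and harmonic: "\<And>k. k \<in> K \<Longrightarrow> wstar k = (\<Sum>l<N. a l k *\<^sub>R wstar l)"
    and tau: "\<And>k. k < N \<Longrightarrow> 0 < \<tau> k \<and> \<tau> k \<le> 1"
    and lip: "\<And>k x y. k < N \<Longrightarrow> norm (g k x - g k y) \<le> L * norm (x - y)"
    and c: "0 \<le> c"
  shows "\<exists>\<mu>0>0. \<exists>c'\<ge>0. \<forall>\<mu>. 0 < \<mu> \<and> \<mu> < \<mu>0 \<longrightarrow>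
    (\<forall>(P :: 'o measure) w s. diffusion_run P N a \<tau> \<beta> \<sigma> g wstar \<mu> w s \<longrightarrow>
      (\<forall>\<^sub>F n in sequentially. \<forall>k\<in>{..<N} - K. diffusion_run.mse P wstar w k n \<le> c * \<mu>) \<longrightarrow>
      (\<forall>\<^sub>F n in sequentially. \<forall>k\<in>K. diffusion_run.mse P wstar w k n \<le> c' * \<mu>))"
proof -
  have fin: "finite K" using K finite_subset by blast
  \<comment> \<open>A common bound for all weights; the leading 1 keeps H \<ge> 1 for empty
    \<open>K\<close> as well.\<close>
  define H where "H = 1 + (\<Sum>k\<in>K. h k)"
  have hH: "h k \<le> H" if "k \<in> K" for k
    using member_le_sum[of k K h] that fin h1 by (force simp: H_def)
  have "0 \<le> (\<Sum>k\<in>K. h k)" using h1 by (intro sum_nonneg) force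
  then have H: "1 \<le> H" by (simp add: H_def)
  define C where "C = (\<Sum>l<N. 4 * L\<^sup>2 + 4 * (norm (g l (wstar l)))\<^sup>2 + 2 * (\<beta> l)\<^sup>2 + 2 * (\<sigma> l)\<^sup>2)"
  have C: "0 \<le> C" by (auto simp: C_def intro!: sum_nonneg)
  \<comment> \<open>\<open>E\<close> measures the feedback of the receiving errors through the step,
    \<open>B\<close> the forcing by the other agents and by constants. The factor 1 + H is 1 + 1 /
    \<eta> from Young's inequality with \<eta> = 1 / H.\<close>
  define E where "E = (1 + H) * (2 * C * H\<^sup>2)"
  have E: "0 \<le> E" using H C by (simp add: E_def)
  define B where "B = (1 + H) * (2 * c + 2 * C * (c + 1))"
  have B: "0 \<le> B" using H C c by (simp add: B_def)
  \<comment> \<open>The second bound keeps E * \<mu> below 1 / (2 * H), half of the contraction gap;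
    the first gives \<mu>^2 \<le> \<mu>.\<close>
  define \<mu>0 where "\<mu>0 = min 1 (1 / (2 * H * (E + 1)))"
  have \<mu>0: "0 < \<mu>0" using H E by (simp add: \<mu>0_def)
  \<comment> \<open>\<open>H\<^sup>2\<close> removes the weights, 2 * H * B is the fixed point per
    unit of \<mu>, and 1 is the strict slack.\<close>
  define c' where "c' = H\<^sup>2 * (2 * H * B + 1)"
  have c': "0 \<le> c'" using H B by (simp add: c'_def)
  have "\<forall>\<^sub>F n in sequentially. \<forall>k\<in>K. diffusion_run.mse P wstar w k n \<le> c' * \<mu>"
    if \<mu>: "0 < \<mu>" "\<mu> < \<mu>0" and run: "diffusion_run P N a \<tau> \<beta> \<sigma> g wstar \<mu> w s"
      and outside: "\<forall>\<^sub>F n in sequentially. \<forall>k\<in>{..<N} - K. diffusion_run.mse P wstar w k n \<le> c * \<mu>"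
    for \<mu> and P :: "'o measure" and w s
  proof -
    interpret diffusion_run P N a \<tau> \<beta> \<sigma> g wstar \<mu> w s by fact
    have \<mu>1: "\<mu> \<le> 1" using \<mu> by (simp add: \<mu>0_def)
    define t where "t n l x = \<tau> l *\<^sub>R (g l (w n l x) + s n l x)" for n l x
    have sq_t: "sq_int P (t n l)" if "l < N" for n l
      unfolding t_def[abs_def] using that
      by (intro sq_int_scaleR sq_int_add sq_int_g sq_int_w sq_int_s)
    have t_le: "expectation (\<lambda>x. (norm (t n l x))\<^sup>2) \<le> C * (mse l n + 1)" if l: "l < N" for n l
    proof -
      have "expectation (\<lambda>x. (norm (t n l x))\<^sup>2)
          \<le> (4 * L\<^sup>2 + 4 * (norm (g l (wstar l)))\<^sup>2 + 2 * (\<beta> l)\<^sup>2 + 2 * (\<sigma> l)\<^sup>2) * (mse l n + 1)"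
        unfolding t_def using l tau lip by (intro expectation_drive_le) auto
      also have "\<dots> \<le> C * (mse l n + 1)"
        unfolding C_def using l mse_nonneg[of l n]
        by (intro mult_right_mono member_le_sum[where f = "\<lambda>l. 4 * L\<^sup>2 + 4 * (norm (g l (wstar l)))\<^sup>2 + 2 * (\<beta> l)\<^sup>2 + 2 * (\<sigma> l)\<^sup>2"]) auto
      finally show ?thesis .
    qed
    define O' where "O' = {..<N} - K"
    have split: "(\<Sum>l<N. f l) = (\<Sum>l\<in>K. f l) + (\<Sum>l\<in>O'. f l)" for f :: "nat \<Rightarrow> real"
      using sum.subset_diff[OF K, of f] by (simp add: O'_def add.commute)
    have splitv: "(\<Sum>l<N. f l) = (\<Sum>l\<in>K. f l) + (\<Sum>l\<in>O'. f l)" for f :: "nat \<Rightarrow> real^'M"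
      using sum.subset_diff[OF K, of f] by (simp add: O'_def add.commute)
    define \<eta> where "\<eta> = 1 / H"
    have \<eta>: "0 < \<eta>" and \<eta>H: "1 + 1 / \<eta> = 1 + H" using H by (auto simp: \<eta>_def)
    \<comment> \<open>Young's inequality separates the errors inside \<open>K\<close> from
      everything else; weighted Cauchy-Schwarz and the equation for \<open>h\<close> produce the
      factor h k - 1.\<close>
    have mse_Suc: "mse k (Suc n) \<le> (1 + \<eta>) * ((h k - 1) * (\<Sum>l\<in>K. a l k * (mse l n / h l)))
        + (1 + H) * (2 * (\<Sum>l\<in>O'. a l k * mse l n) + 2 * \<mu>\<^sup>2 * (\<Sum>l<N. a l k * (C * (mse l n + 1))))"
      if k: "k \<in> K" for k n
    proof -
      have kN: "k < N" using k K by auto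
      have ak: "0 \<le> a l k" if "l < N" for l using a kN that by blast
      have sub: "K \<subseteq> {..<N}" "O' \<subseteq> {..<N}" using K by (auto simp: O'_def)
      have OsumS: "(\<Sum>l\<in>O'. a l k) \<le> 1"
        using sum_mono2[OF _ sub(2), of "\<lambda>l. a l k"] ak stoch[OF kN] by auto
      have hK: "(\<Sum>l\<in>K. a l k * h l) = h k - 1" using h[OF k] by simp
      let ?R = "\<lambda>x. (1 + \<eta>) * ((h k - 1) * (\<Sum>l\<in>K. a l k * ((norm (err n l x))\<^sup>2 / h l)))
        + (1 + H) * (2 * (\<Sum>l\<in>O'. a l k * (norm (err n l x))\<^sup>2) + 2 * \<mu>\<^sup>2 * (\<Sum>l<N. a l k * (norm (t n l x))\<^sup>2))"
      have pw: "(norm (err (Suc n) k x))\<^sup>2 \<le> ?R x" if x: "x \<in> space P" for x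
      proof -
        define y where "y = (\<Sum>l\<in>O'. a l k *\<^sub>R err n l x) - \<mu> *\<^sub>R (\<Sum>l<N. a l k *\<^sub>R t n l x)"
        have "err (Suc n) k x = (\<Sum>l<N. a l k *\<^sub>R (w n l x - (\<tau> l * \<mu>) *\<^sub>R (g l (w n l x) + s n l x)))
            - (\<Sum>l<N. a l k *\<^sub>R wstar l)"
          using w_Suc[OF kN x] harmonic[OF k] by (simp add: err_def)
        also have "\<dots> = (\<Sum>l<N. a l k *\<^sub>R err n l x) - \<mu> *\<^sub>R (\<Sum>l<N. a l k *\<^sub>R t n l x)"
          unfolding scaleR_sum_right sum_subtractf[symmetric]
          by (intro sum.cong refl) (simp add: err_def t_def algebra_simps)
        finally have "err (Suc n) k x = (\<Sum>l\<in>K. a l k *\<^sub>R err n l x) + y"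
          by (simp add: splitv[of "\<lambda>l. a l k *\<^sub>R err n l x"] y_def)
        then have "(norm (err (Suc n) k x))\<^sup>2
            \<le> (1 + \<eta>) * (norm (\<Sum>l\<in>K. a l k *\<^sub>R err n l x))\<^sup>2 + (1 + H) * (norm y)\<^sup>2"
          using norm_add_power2_le[OF \<eta>, of "\<Sum>l\<in>K. a l k *\<^sub>R err n l x" y] by (simp add: \<eta>H)
        also have "\<dots> \<le> ?R x"
        proof (intro add_mono mult_left_mono)
          show "(norm (\<Sum>l\<in>K. a l k *\<^sub>R err n l x))\<^sup>2
              \<le> (h k - 1) * (\<Sum>l\<in>K. a l k * ((norm (err n l x))\<^sup>2 / h l))"
          proof -
            have "0 \<le> a l k" "0 < h l" if "l \<in> K" for l using ak sub h1[OF that] that by auto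
            then show ?thesis unfolding hK[symmetric] by (rule norm_weighted_sum_power2_le)
          qed
          have O: "(norm (\<Sum>l\<in>O'. a l k *\<^sub>R err n l x))\<^sup>2 \<le> (\<Sum>l\<in>O'. a l k * (norm (err n l x))\<^sup>2)"
          proof -
            have "(norm (\<Sum>l\<in>O'. a l k *\<^sub>R err n l x))\<^sup>2
                \<le> (\<Sum>l\<in>O'. a l k) * (\<Sum>l\<in>O'. a l k * (norm (err n l x))\<^sup>2)"
              using ak sub by (intro norm_weighted_sum_power2_le1) auto
            also have "\<dots> \<le> 1 * (\<Sum>l\<in>O'. a l k * (norm (err n l x))\<^sup>2)"
              using OsumS ak sub by (intro mult_right_mono sum_nonneg mult_nonneg_nonneg) auto
            finally show ?thesis by simp
          qed
          have T: "(norm (\<Sum>l<N. a l k *\<^sub>R t n l x))\<^sup>2 \<le> (\<Sum>l<N. a l k * (norm (t n l x))\<^sup>2)"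
            using norm_weighted_sum_power2_le1[of "{..<N}" "\<lambda>l. a l k" "\<lambda>l. t n l x"] ak stoch[OF kN]
            by simp
          have "(norm y)\<^sup>2 \<le> 2 * (norm (\<Sum>l\<in>O'. a l k *\<^sub>R err n l x))\<^sup>2
              + 2 * (\<mu>\<^sup>2 * (norm (\<Sum>l<N. a l k *\<^sub>R t n l x))\<^sup>2)"
            using norm_diff_power2_le2[of "\<Sum>l\<in>O'. a l k *\<^sub>R err n l x" "\<mu> *\<^sub>R (\<Sum>l<N. a l k *\<^sub>R t n l x)"]
            by (simp add: y_def power_mult_distrib)
          also have "\<dots> \<le> 2 * (\<Sum>l\<in>O'. a l k * (norm (err n l x))\<^sup>2)
              + 2 * (\<mu>\<^sup>2 * (\<Sum>l<N. a l k * (norm (t n l x))\<^sup>2))"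
            by (intro add_mono mult_left_mono O T) auto
          finally show "(norm y)\<^sup>2 \<le> 2 * (\<Sum>l\<in>O'. a l k * (norm (err n l x))\<^sup>2)
              + 2 * \<mu>\<^sup>2 * (\<Sum>l<N. a l k * (norm (t n l x))\<^sup>2)" by simp
        qed (use \<eta> H in auto)
        finally show ?thesis .
      qed
      have ie: "integrable P (\<lambda>x. (norm (err n l x))\<^sup>2)" "integrable P (\<lambda>x. (norm (t n l x))\<^sup>2)" if "l < N" for l n
        using sq_int_err[OF that] sq_t[OF that] by (auto simp: sq_int_def)
      have i1: "integrable P (\<lambda>x. \<Sum>l\<in>K. a l k * ((norm (err n l x))\<^sup>2 / h l))"
        using sub ie by (intro Bochner_Integration.integrable_sum integrable_mult_right integrable_divide) auto
      have i2: "integrable P (\<lambda>x. \<Sum>l\<in>O'. a l k * (norm (err n l x))\<^sup>2)"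
        using sub ie by (intro Bochner_Integration.integrable_sum integrable_mult_right) auto
      have i3: "integrable P (\<lambda>x. \<Sum>l<N. a l k * (norm (t n l x))\<^sup>2)"
        using ie by (intro Bochner_Integration.integrable_sum integrable_mult_right) auto
      have e1: "expectation (\<lambda>x. \<Sum>l\<in>K. a l k * ((norm (err n l x))\<^sup>2 / h l)) = (\<Sum>l\<in>K. a l k * (mse l n / h l))"
        using sub ie by (subst Bochner_Integration.integral_sum) (auto simp: mse_def)
      have e2: "expectation (\<lambda>x. \<Sum>l\<in>O'. a l k * (norm (err n l x))\<^sup>2) = (\<Sum>l\<in>O'. a l k * mse l n)"
        using sub ie by (subst Bochner_Integration.integral_sum) (auto simp: mse_def)
      have "expectation (\<lambda>x. \<Sum>l<N. a l k * (norm (t n l x))\<^sup>2) = (\<Sum>l<N. a l k * expectation (\<lambda>x. (norm (t n l x))\<^sup>2))"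
        using ie by (subst Bochner_Integration.integral_sum) auto
      also have "\<dots> \<le> (\<Sum>l<N. a l k * (C * (mse l n + 1)))"
        using ak t_le by (intro sum_mono mult_left_mono) auto
      finally have e3: "expectation (\<lambda>x. \<Sum>l<N. a l k * (norm (t n l x))\<^sup>2) \<le> (\<Sum>l<N. a l k * (C * (mse l n + 1)))" .
      have "mse k (Suc n) \<le> expectation ?R"
        unfolding mse_def using ie(1)[OF kN] i1 i2 i3 pw by (intro integral_mono) auto
      also have "\<dots> = (1 + \<eta>) * ((h k - 1) * (\<Sum>l\<in>K. a l k * (mse l n / h l)))
        + (1 + H) * (2 * (\<Sum>l\<in>O'. a l k * mse l n) + 2 * \<mu>\<^sup>2 * expectation (\<lambda>x. \<Sum>l<N. a l k * (norm (t n l x))\<^sup>2))"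
        using i1 i2 i3 by (simp add: e1 e2 del: Bochner_Integration.integral_sum times_divide_eq_right)
      also have "\<dots> \<le> (1 + \<eta>) * ((h k - 1) * (\<Sum>l\<in>K. a l k * (mse l n / h l)))
        + (1 + H) * (2 * (\<Sum>l\<in>O'. a l k * mse l n) + 2 * \<mu>\<^sup>2 * (\<Sum>l<N. a l k * (C * (mse l n + 1))))"
        using H by (intro add_left_mono mult_left_mono e3) auto
      finally show ?thesis .
    qed
    define q where "q = 1 - 1 / (2 * H)"
    have q: "0 \<le> q" "q < 1" using H by (auto simp: q_def field_simps)
    \<comment> \<open>The squared contraction outweighs Young's factor 1 + \<eta>: one power of 1 -
      \<eta> remains, and half of its gap pays for the feedback.\<close>
    have qE: "(1 + \<eta>) * (1 - \<eta>)\<^sup>2 + E * \<mu>\<^sup>2 \<le> q"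
    proof -
      have \<eta>1: "\<eta> \<le> 1" using H by (simp add: \<eta>_def)
      have "(1 + \<eta>) * (1 - \<eta>)\<^sup>2 = (1 - \<eta>) * (1 - \<eta>\<^sup>2)" by (simp add: power2_eq_square algebra_simps)
      also have "\<dots> \<le> (1 - \<eta>) * 1" using \<eta>1 by (intro mult_left_mono) auto
      finally have 1: "(1 + \<eta>) * (1 - \<eta>)\<^sup>2 \<le> 1 - \<eta>" by simp
      have "\<mu> * (2 * H * (E + 1)) \<le> 1" using \<mu> H E by (simp add: \<mu>0_def less_divide_eq)
      moreover have "\<mu> * (2 * H * (E + 1)) = \<mu> * (2 * H * E) + \<mu> * (2 * H)" by (simp add: distrib_left)
      moreover have "0 \<le> \<mu> * (2 * H)" using \<mu> H by simp
      ultimately have "\<mu> * (2 * H * E) \<le> 1" by linarith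
      then have "E * \<mu> \<le> 1 / (2 * H)" using H by (simp add: field_simps)
      moreover have "E * \<mu>\<^sup>2 \<le> E * \<mu>"
        using E \<mu> \<mu>1 by (intro mult_left_mono) (auto simp: power2_eq_square mult_left_le)
      ultimately have "E * \<mu>\<^sup>2 \<le> 1 / (2 * H)" by simp
      moreover have "q = (1 - \<eta>) + 1 / (2 * H)" using H by (simp add: q_def \<eta>_def field_simps)
      ultimately show ?thesis using 1 by simp
    qed
    \<comment> \<open>The weights are squared because \<open>h\<close> weights norms, whereas
      \<open>mse\<close> is a mean of squared norms.\<close>
    have rec: "\<forall>\<^sub>F n in sequentially. \<forall>y\<ge>0. (\<forall>l\<in>K. mse l n \<le> (h l)\<^sup>2 * y) \<longrightarrow>
        (\<forall>k\<in>K. mse k (Suc n) \<le> (h k)\<^sup>2 * (q * y + B * \<mu>))"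
      using outside
    proof eventually_elim
      case (elim n)
      show ?case
      proof (intro allI impI ballI)
        fix y k assume y: "0 \<le> (y::real)" and le: "\<forall>l\<in>K. mse l n \<le> (h l)\<^sup>2 * y" and k: "k \<in> K"
        have kN: "k < N" using k K by auto
        have ak: "0 \<le> a l k" if "l < N" for l using a kN that by blast
        have sums: "(\<Sum>l\<in>K. a l k) \<le> 1" "(\<Sum>l\<in>O'. a l k) \<le> 1"
        proof -
          have "0 \<le> (\<Sum>l\<in>K. a l k)" "0 \<le> (\<Sum>l\<in>O'. a l k)"
            using ak K by (auto intro!: sum_nonneg simp: O'_def)
          then show "(\<Sum>l\<in>K. a l k) \<le> 1" "(\<Sum>l\<in>O'. a l k) \<le> 1"
            using stoch[OF kN] split[of "\<lambda>l. a l k"] by auto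
        qed
        have hk: "1 \<le> h k" using h1 k .
        have "(\<Sum>l\<in>K. a l k * (mse l n / h l)) \<le> (\<Sum>l\<in>K. a l k * (h l * y))"
        proof (intro sum_mono mult_left_mono)
          fix l assume l: "l \<in> K"
          have "0 < h l" using h1[OF l] by simp
          then show "mse l n / h l \<le> h l * y" using le l by (simp add: divide_le_eq power2_eq_square mult_ac)
          show "0 \<le> a l k" using l K ak by auto
        qed
        also have "\<dots> = (h k - 1) * y" using h[OF k] by (simp add: sum_distrib_right mult.assoc)
        finally have "(h k - 1) * (\<Sum>l\<in>K. a l k * (mse l n / h l)) \<le> (h k - 1) * ((h k - 1) * y)"
          using hk by (intro mult_left_mono) auto
        also have "\<dots> = (h k - 1)\<^sup>2 * y" by (simp add: power2_eq_square)
        also have "\<dots> \<le> ((1 - \<eta>) * h k)\<^sup>2 * y"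
        proof (intro mult_right_mono power_mono y)
          \<comment> \<open>Here the common bound \<open>H\<close> enters: the 1 lost in h k - 1 is
            at least the fraction \<eta> of \<open>h k\<close>.\<close>
          have "\<eta> * h k \<le> 1" using hH[OF k] H by (simp add: \<eta>_def divide_le_eq)
          then show "h k - 1 \<le> (1 - \<eta>) * h k" by (simp add: algebra_simps)
        qed (use hk in auto)
        finally have 1: "(1 + \<eta>) * ((h k - 1) * (\<Sum>l\<in>K. a l k * (mse l n / h l)))
            \<le> (1 + \<eta>) * (((1 - \<eta>) * h k)\<^sup>2 * y)" using \<eta> by (intro mult_left_mono) auto
        have "(\<Sum>l\<in>O'. a l k * mse l n) \<le> (\<Sum>l\<in>O'. a l k * (c * \<mu>))"
          using elim ak by (intro sum_mono mult_left_mono) (auto simp: O'_def)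
        also have "\<dots> = (\<Sum>l\<in>O'. a l k) * (c * \<mu>)" by (simp add: sum_distrib_right)
        also have "\<dots> \<le> 1 * (c * \<mu>)" using sums c \<mu> by (intro mult_right_mono) auto
        finally have 2: "(\<Sum>l\<in>O'. a l k * mse l n) \<le> c * \<mu>" by simp
        have "mse l n \<le> H\<^sup>2 * y" if l: "l \<in> K" for l
        proof -
          have "(h l)\<^sup>2 * y \<le> H\<^sup>2 * y" using hH[OF l] h1[OF l] y by (intro mult_right_mono power_mono) auto
          then show ?thesis using le l by force
        qed
        then have "(\<Sum>l\<in>K. a l k * mse l n) \<le> (\<Sum>l\<in>K. a l k * (H\<^sup>2 * y))"
          using ak K by (intro sum_mono mult_left_mono) auto
        also have "\<dots> = (\<Sum>l\<in>K. a l k) * (H\<^sup>2 * y)" by (simp add: sum_distrib_right)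
        also have "\<dots> \<le> 1 * (H\<^sup>2 * y)" using sums y by (intro mult_right_mono) auto
        finally have 3: "(\<Sum>l\<in>K. a l k * mse l n) \<le> H\<^sup>2 * y" by simp
        have "c * \<mu> \<le> c * 1" using c \<mu>1 by (intro mult_left_mono) auto
        then have "(\<Sum>l<N. a l k * mse l n) + 1 \<le> H\<^sup>2 * y + (c + 1)"
          using 2 3 split[of "\<lambda>l. a l k * mse l n"] by simp
        then have "C * ((\<Sum>l<N. a l k * mse l n) + 1) \<le> C * (H\<^sup>2 * y + (c + 1))"
          using C by (intro mult_left_mono) auto
        moreover have "(\<Sum>l<N. a l k * (C * (mse l n + 1))) = C * ((\<Sum>l<N. a l k * mse l n) + 1)"
        proof -
          have "(\<Sum>l<N. a l k * (C * (mse l n + 1))) = (\<Sum>l<N. C * (a l k * mse l n) + C * a l k)"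
            by (intro sum.cong refl) (simp add: algebra_simps)
          also have "\<dots> = C * ((\<Sum>l<N. a l k * mse l n) + 1)"
            by (simp add: sum.distrib sum_distrib_left[symmetric] stoch[OF kN] distrib_left)
          finally show ?thesis .
        qed
        ultimately have 4: "(\<Sum>l<N. a l k * (C * (mse l n + 1))) \<le> C * (H\<^sup>2 * y + (c + 1))" by simp
        have "mse k (Suc n) \<le> (1 + \<eta>) * (((1 - \<eta>) * h k)\<^sup>2 * y)
            + (1 + H) * (2 * (c * \<mu>) + 2 * \<mu>\<^sup>2 * (C * (H\<^sup>2 * y + (c + 1))))"
          by (rule order_trans[OF mse_Suc[OF k]], intro add_mono 1 mult_left_mono 2 4) (use H in auto)
        also have "\<dots> = (h k)\<^sup>2 * ((1 + \<eta>) * (1 - \<eta>)\<^sup>2 * y) + E * \<mu>\<^sup>2 * y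
            + (1 + H) * (2 * (c * \<mu>) + 2 * C * (c + 1) * \<mu>\<^sup>2)"
          unfolding E_def power_mult_distrib by (simp add: algebra_simps)
        also have "\<dots> \<le> (h k)\<^sup>2 * ((1 + \<eta>) * (1 - \<eta>)\<^sup>2 * y) + (h k)\<^sup>2 * (E * \<mu>\<^sup>2 * y) + (h k)\<^sup>2 * (B * \<mu>)"
        proof (intro add_mono order_refl)
          \<comment> \<open>As the weights are at least 1, terms free of weights can be given the
            factor \<open>(h k)\<^sup>2\<close> as well.\<close>
          have hk2: "1 \<le> (h k)\<^sup>2" using hk by simp
          show "E * \<mu>\<^sup>2 * y \<le> (h k)\<^sup>2 * (E * \<mu>\<^sup>2 * y)"
            using mult_right_mono[OF hk2, of "E * \<mu>\<^sup>2 * y"] E y by simp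
          have "\<mu>\<^sup>2 \<le> \<mu>" using \<mu> \<mu>1 by (simp add: power2_eq_square mult_left_le)
          then have "(1 + H) * (2 * (c * \<mu>) + 2 * C * (c + 1) * \<mu>\<^sup>2) \<le> (1 + H) * (2 * (c * \<mu>) + 2 * C * (c + 1) * \<mu>)"
            using H C c by (intro mult_left_mono add_left_mono) auto
          also have "\<dots> = B * \<mu>" by (simp add: B_def algebra_simps)
          also have "\<dots> \<le> (h k)\<^sup>2 * (B * \<mu>)"
            using mult_right_mono[OF hk2, of "B * \<mu>"] B \<mu> by simp
          finally show "(1 + H) * (2 * (c * \<mu>) + 2 * C * (c + 1) * \<mu>\<^sup>2) \<le> (h k)\<^sup>2 * (B * \<mu>)" .
        qed
        also have "\<dots> = (h k)\<^sup>2 * (((1 + \<eta>) * (1 - \<eta>)\<^sup>2 + E * \<mu>\<^sup>2) * y + B * \<mu>)"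
          by (simp add: algebra_simps)
        also have "\<dots> \<le> (h k)\<^sup>2 * (q * y + B * \<mu>)"
          using qE y by (intro mult_left_mono add_right_mono mult_right_mono) auto
        finally show "mse k (Suc n) \<le> (h k)\<^sup>2 * (q * y + B * \<mu>)" .
      qed
    qed
    have "B * \<mu> / (1 - q) = 2 * H * B * \<mu>" using H by (simp add: q_def)
    also have "\<dots> < (2 * H * B + 1) * \<mu>" using \<mu> by (simp add: distrib_right)
    finally have "\<forall>\<^sub>F n in sequentially. \<forall>k\<in>K. mse k n \<le> (h k)\<^sup>2 * ((2 * H * B + 1) * \<mu>)"
      using h1 mse_nonneg B \<mu>
      by (intro eventually_weighted_sup_le[OF fin q, where b = "B * \<mu>"] rec) (force intro: zero_less_power)+
    then show "\<forall>\<^sub>F n in sequentially. \<forall>k\<in>K. mse k n \<le> c' * \<mu>"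
    proof eventually_elim
      case (elim n)
      show ?case
      proof
        fix k assume k: "k \<in> K"
        have "mse k n \<le> (h k)\<^sup>2 * ((2 * H * B + 1) * \<mu>)" using elim k by blast
        also have "\<dots> \<le> H\<^sup>2 * ((2 * H * B + 1) * \<mu>)"
          using hH[OF k] h1[OF k] H B \<mu> by (intro mult_right_mono power_mono) auto
        finally show "mse k n \<le> c' * \<mu>" by (simp add: c'_def mult_ac)
      qed
    qed
  qed
  then show ?thesis
    using \<mu>0 c' by (intro exI[of _ \<mu>0] exI[of _ c'] conjI allI impI) auto
qed

section \<open>Assembly for the whole network\<close>

text \<open>Serves to identify group \<open>S\<close>, an initial segment by monotonicity of
  \<open>sn\<close>, with the agents below \<open>NgS\<close>.\<close>

lemma downward_closed_eq_lessThan_card: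
  fixes A :: "nat set"
  assumes "finite A" and down: "\<And>i j. j \<in> A \<Longrightarrow> i \<le> j \<Longrightarrow> i \<in> A"
  shows "A = {..<card A}"
proof (cases "A = {}")
  case False
  then have "A = {..Max A}"
    using assms(1) by (auto intro: down[OF Max_in])
  then show ?thesis by (metis card_atMost lessThan_Suc_atMost)
qed simp

theorem theorem1:
  fixes N S R NgS :: nat
    and sn :: "nat \<Rightarrow> nat"
    and a :: "nat \<Rightarrow> nat \<Rightarrow> real"
    and J :: "nat \<Rightarrow> real^'M \<Rightarrow> real"
    and grad :: "nat \<Rightarrow> real^'M \<Rightarrow> real^'M"
    and H :: "nat \<Rightarrow> real^'M \<Rightarrow> real^'M^'M"
    and \<tau> p \<beta> \<sigma> :: "nat \<Rightarrow> real"
    and ws :: "nat \<Rightarrow> real^'M"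
    and wstar :: "nat \<Rightarrow> real^'M"
  assumes S_pos: "S > 0"
    and sn_range: "\<forall>k<N. sn k < S + R"
    and sn_nonempty: "\<forall>s<S+R. \<exists>k<N. sn k = s"
    and sn_mono: "mono_on {..<N} sn"
    and NgS_def: "NgS = card {k. k < N \<and> sn k < S}"
    and a_nonneg: "\<forall>l<N. \<forall>k<N. a l k \<ge> 0"
    and a_left_stoch: "\<forall>k<N. (\<Sum>l<N. a l k) = 1"
    and a_upper: "\<forall>l<N. \<forall>k<N. sn k < sn l \<longrightarrow> a l k = 0"
    and a_blockdiag_S: "\<forall>l<N. \<forall>k<N. sn k < S \<and> sn l \<noteq> sn k \<longrightarrow> a l k = 0"
    and A_S_primitive: "\<forall>s<S. primitive_sub (subnet N sn s) a"
    and A_R_irred: "\<forall>r. S \<le> r \<and> r < S + R \<longrightarrow> irreducible_sub (subnet N sn r) a"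
    and A_R_deficient: "\<forall>r. S \<le> r \<and> r < S + R \<longrightarrow>
         (\<exists>k\<in>subnet N sn r. (\<Sum>l\<in>subnet N sn r. a l k) < 1)"
    and perron: "\<forall>s<S. (\<forall>k\<in>subnet N sn s. (\<Sum>l\<in>subnet N sn s. a k l * p l) = p k \<and> p k > 0)
         \<and> (\<Sum>k\<in>subnet N sn s. p k) = 1"
    and tau: "\<forall>k<N. 0 < \<tau> k \<and> \<tau> k \<le> 1"
    and convex: "\<forall>k<N. convex_on UNIV (J k)"
    and grad: "\<forall>k<N. \<forall>w. (J k has_derivative (\<lambda>h. grad k w \<bullet> h)) (at w)"
    and hess: "\<forall>k<N. \<forall>w. (grad k has_derivative (\<lambda>h. H k w *v h)) (at w)"
    and hess_bounded: "\<exists>L. \<forall>k<N. \<forall>w. onorm (\<lambda>h. H k w *v h) \<le> L"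
    and strongly_convex: "\<forall>s<S. \<exists>k\<in>subnet N sn s. strongly_convex_on UNIV (J k)"
    and ws_def: "\<forall>s<S. (\<Sum>k\<in>subnet N sn s. (\<tau> k * p k) *\<^sub>R grad k (ws s)) = 0"
    and wstar_S: "\<forall>k<N. sn k < S \<longrightarrow> wstar k = ws (sn k)"
    and wstar_R: "\<forall>k. NgS \<le> k \<and> k < N \<longrightarrow>
         wstar k = (\<Sum>l<NgS. W_mat N NgS a $$ (l, k - NgS) *\<^sub>R wstar l)"
    and noise_consts: "\<forall>k<N. \<beta> k \<ge> 0 \<and> \<sigma> k \<ge> 0"
  shows "\<exists>\<mu>bar>0. \<exists>c. \<forall>\<mu>max. 0 < \<mu>max \<and> \<mu>max < \<mu>bar \<longrightarrow>
    (\<forall>(P :: 'o measure) (w :: nat \<Rightarrow> nat \<Rightarrow> 'o \<Rightarrow> real^'M) (s :: nat \<Rightarrow> nat \<Rightarrow> 'o \<Rightarrow> real^'M).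
       prob_space P
       \<and> (\<forall>n k. k < N \<longrightarrow> w n k \<in> borel_measurable P \<and> s n k \<in> borel_measurable P)
       \<and> (\<forall>k<N. integrable P (\<lambda>x. (norm (w 0 k x))\<^sup>2))
       \<and> (\<forall>n. \<forall>k<N. \<forall>x\<in>space P.
            w (Suc n) k x = (\<Sum>l<N. a l k *\<^sub>R
               (w n l x - (\<tau> l * \<mu>max) *\<^sub>R (grad l (w n l x) + s n l x))))
       \<and> (\<forall>n. \<forall>k<N. integrable P (\<lambda>x. (norm (s n k x))\<^sup>2))
       \<and> (\<forall>n. \<forall>k<N. \<forall>j. AE x in P. real_cond_exp P (filt P N w n) (\<lambda>y. s n k y $ j) x = 0)
       \<and> (\<forall>n. \<forall>k<N. \<forall>l<N. k \<noteq> l \<longrightarrow> (\<forall>j j'. AE x in P.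
            real_cond_exp P (filt P N w n) (\<lambda>y. s n k y $ j * s n l y $ j') x = 0))
       \<and> (\<forall>n. \<forall>k<N. AE x in P.
            nn_cond_exp P (filt P N w n) (\<lambda>y. ennreal ((norm (s n k y))\<^sup>2)) x
              \<le> ennreal ((\<beta> k)\<^sup>2 * (norm (wstar k - w n k x))\<^sup>2 + (\<sigma> k)\<^sup>2))
     \<longrightarrow> (\<forall>k<N. limsup (\<lambda>n. \<integral>\<^sup>+ x. ennreal ((norm (wstar k - w (Suc n) k x))\<^sup>2) \<partial>P)
              \<le> ennreal (c * \<mu>max)))"
proof -
  have group_S: "{k. k < N \<and> sn k < S} = {..<NgS}"
    unfolding NgS_def
    by (rule downward_closed_eq_lessThan_card)
       (auto dest: mono_onD[OF sn_mono] intro: le_less_trans[OF mono_onD[OF sn_mono]])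
  have NgS: "NgS \<le> N" using group_S by (metis (no_types, lifting) lessThan_iff lessThan_subset_iff mem_Collect_eq subsetI)
  have less_NgS: "k < NgS \<longleftrightarrow> sn k < S" if "k < N" for k using group_S that by blast
  obtain L where L: "\<And>k w. k < N \<Longrightarrow> onorm (\<lambda>h. H k w *v h) \<le> L" using hess_bounded by blast
  \<comment> \<open>Mean value inequality: the Hessian bound becomes a common Lipschitz
    constant.\<close>
  have lip: "norm (grad k x - grad k y) \<le> L * norm (x - y)" if "k < N" for k x y
    using hess L that by (intro differentiable_bound[of UNIV _ "\<lambda>w h. H k w *v h"]) auto
  let ?I = "subnet N sn"
  have block: "\<exists>m \<nu>. diffusion_block (?I s) a p m \<tau> grad L \<nu> (ws s)" if s: "s < S" for s
  proof -
    have I_sub: "?I s \<subseteq> {..<N}" and finI: "finite (?I s)" by (auto simp: subnet_def)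
    have "primitive_sub (?I s) a" using A_S_primitive s by blast
    then obtain m where m: "0 < m" "\<forall>i\<in>?I s. \<forall>j\<in>?I s. 0 < sub_mat_pow (?I s) a m i j"
      unfolding primitive_sub_def by blast
    have p: "0 < p k" if "k \<in> ?I s" for k using perron s that by blast
    have tauI: "0 < \<tau> k \<and> \<tau> k \<le> 1" if "k \<in> ?I s" for k using tau that I_sub by blast
    obtain k0 where k0: "k0 \<in> ?I s" "strongly_convex_on UNIV (J k0)" using strongly_convex s by blast
    then obtain \<nu>0 where \<nu>0: "0 < \<nu>0"
      "\<And>x y. \<nu>0 * (norm (x - y))\<^sup>2 \<le> inner (x - y) (grad k0 x - grad k0 y)"
      using strongly_convex_gradient_mono[of "J k0" "grad k0"] grad I_sub by (metis lessThan_iff subsetD)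
    have mono: "0 \<le> inner (x - y) (grad k x - grad k y)" if "k \<in> ?I s" for k x y
      using convex_gradient_mono[of "J k" "grad k"] convex grad that I_sub by blast
    \<comment> \<open>The monotonicity constant counts only the strongly convex cost, with its
      weight in the sum; convexity makes the contributions of the others nonnegative.\<close>
    have "diffusion_block (?I s) a p m \<tau> grad L (\<tau> k0 * p k0 * \<nu>0) (ws s)"
    proof unfold_locales
      show "(\<Sum>l\<in>?I s. a l k) = 1" if k: "k \<in> ?I s" for k
      proof -
        have kN: "k < N" "sn k = s" using k by (auto simp: subnet_def)
        have "(\<Sum>l<N. a l k) = (\<Sum>l\<in>?I s. a l k)"
          using I_sub kN a_blockdiag_S s by (intro sum.mono_neutral_right) (auto simp: subnet_def)
        then show ?thesis using a_left_stoch kN by simp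
      qed
      show "0 < \<tau> k0 * p k0 * \<nu>0" using \<nu>0 p tauI k0 by simp
      show "\<tau> k0 * p k0 * \<nu>0 * (norm x)\<^sup>2 \<le> inner x (\<Sum>k\<in>?I s. (\<tau> k * p k) *\<^sub>R grad k (ws s + x))" for x
      proof -
        have "\<tau> k0 * p k0 * \<nu>0 * (norm x)\<^sup>2 \<le> \<tau> k0 * p k0 * inner x (grad k0 (ws s + x) - grad k0 (ws s))"
          using mult_left_mono[OF \<nu>0(2)[of "ws s + x" "ws s"], of "\<tau> k0 * p k0"] tauI[OF k0(1)] p[OF k0(1)]
          by (simp add: mult.assoc)
        also have "\<dots> \<le> (\<Sum>k\<in>?I s. \<tau> k * p k * inner x (grad k (ws s + x) - grad k (ws s)))"
        proof (rule member_le_sum[OF k0(1) _ finI])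
          fix k assume "k \<in> ?I s - {k0}"
          then show "0 \<le> \<tau> k * p k * inner x (grad k (ws s + x) - grad k (ws s))"
            using mono[of k "ws s + x" "ws s"] tauI[of k] p[of k] by simp
        qed
        \<comment> \<open>The subtracted sum is zero by \<open>ws_def\<close>, which is what allows
          differences of gradients to appear.\<close>
        also have "\<dots> = inner x ((\<Sum>k\<in>?I s. (\<tau> k * p k) *\<^sub>R grad k (ws s + x)) - (\<Sum>k\<in>?I s. (\<tau> k * p k) *\<^sub>R grad k (ws s)))"
          unfolding sum_subtractf[symmetric] inner_sum_right
          by (intro sum.cong refl) (simp add: scaleR_diff_right[symmetric])
        finally show ?thesis using ws_def s by simp
      qed
    qed (use finI I_sub a_nonneg perron s m tauI lip ws_def in \<open>auto simp: subnet_def\<close>)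
    then show ?thesis by blast
  qed
  have "\<forall>s\<in>{..<S}. \<exists>\<mu>0>0. \<exists>c\<ge>0. \<forall>\<mu>. 0 < \<mu> \<and> \<mu> < \<mu>0 \<longrightarrow>
    (\<forall>(P :: 'o measure) w x. diffusion_run P N a \<tau> \<beta> \<sigma> grad wstar \<mu> w x \<longrightarrow>
      (\<forall>\<^sub>F n in sequentially. \<forall>k\<in>?I s. diffusion_run.mse P wstar w k n \<le> c * \<mu>))"
  proof
    fix s assume "s \<in> {..<S}"
    then have s: "s < S" by simp
    then obtain m \<nu> where b: "diffusion_block (?I s) a p m \<tau> grad L \<nu> (ws s)" using block by blast
    show "\<exists>\<mu>0>0. \<exists>c\<ge>0. \<forall>\<mu>. 0 < \<mu> \<and> \<mu> < \<mu>0 \<longrightarrow>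
      (\<forall>(P :: 'o measure) w x. diffusion_run P N a \<tau> \<beta> \<sigma> grad wstar \<mu> w x \<longrightarrow>
        (\<forall>\<^sub>F n in sequentially. \<forall>k\<in>?I s. diffusion_run.mse P wstar w k n \<le> c * \<mu>))"
      using s a_blockdiag_S wstar_S by (intro block_mean_square_bound[OF b]) (auto simp: subnet_def)
  qed
  \<comment> \<open>Thresholds and constants are chosen per sub-network before any run is given;
    being finitely many, they have a positive minimum and a finite sum.\<close>
  from bchoice[OF this] obtain \<mu>S where \<mu>S: "\<forall>s\<in>{..<S}. \<mu>S s > 0 \<and> (\<exists>c\<ge>0. \<forall>\<mu>. 0 < \<mu> \<and> \<mu> < \<mu>S s \<longrightarrow>
    (\<forall>(P :: 'o measure) w x. diffusion_run P N a \<tau> \<beta> \<sigma> grad wstar \<mu> w x \<longrightarrow>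
      (\<forall>\<^sub>F n in sequentially. \<forall>k\<in>?I s. diffusion_run.mse P wstar w k n \<le> c * \<mu>)))" ..
  then have "\<forall>s\<in>{..<S}. \<exists>c. c \<ge> 0 \<and> (\<forall>\<mu>. 0 < \<mu> \<and> \<mu> < \<mu>S s \<longrightarrow>
    (\<forall>(P :: 'o measure) w x. diffusion_run P N a \<tau> \<beta> \<sigma> grad wstar \<mu> w x \<longrightarrow>
      (\<forall>\<^sub>F n in sequentially. \<forall>k\<in>?I s. diffusion_run.mse P wstar w k n \<le> c * \<mu>)))" by simp
  from bchoice[OF this] obtain cS where cS: "\<forall>s\<in>{..<S}. cS s \<ge> 0 \<and> (\<forall>\<mu>. 0 < \<mu> \<and> \<mu> < \<mu>S s \<longrightarrow>
    (\<forall>(P :: 'o measure) w x. diffusion_run P N a \<tau> \<beta> \<sigma> grad wstar \<mu> w x \<longrightarrow>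
      (\<forall>\<^sub>F n in sequentially. \<forall>k\<in>?I s. diffusion_run.mse P wstar w k n \<le> cS s * \<mu>)))" ..
  then have cS0: "\<And>s. s < S \<Longrightarrow> 0 \<le> cS s" by simp
  define c where "c = (\<Sum>s<S. cS s)"
  have c0: "0 \<le> c" using cS0 by (auto simp: c_def intro: sum_nonneg)
  have group_S_bound: "\<forall>\<^sub>F n in sequentially. \<forall>k\<in>{..<NgS}. diffusion_run.mse P wstar w k n \<le> c * \<mu>"
    if \<mu>: "0 < \<mu>" "\<And>s. s < S \<Longrightarrow> \<mu> < \<mu>S s" and run: "diffusion_run P N a \<tau> \<beta> \<sigma> grad wstar \<mu> w x"
    for \<mu> and P :: "'o measure" and w x
  proof -
    have "\<forall>\<^sub>F n in sequentially. \<forall>s\<in>{..<S}. \<forall>k\<in>?I s. diffusion_run.mse P wstar w k n \<le> cS s * \<mu>"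
    proof (rule eventually_ball_finite)
      show "\<forall>s\<in>{..<S}. \<forall>\<^sub>F n in sequentially. \<forall>k\<in>?I s. diffusion_run.mse P wstar w k n \<le> cS s * \<mu>"
      proof
        fix s assume "s \<in> {..<S}"
        then show "\<forall>\<^sub>F n in sequentially. \<forall>k\<in>?I s. diffusion_run.mse P wstar w k n \<le> cS s * \<mu>"
          using cS \<mu>(1) \<mu>(2)[of s] run by blast
      qed
    qed simp
    then show ?thesis
    proof eventually_elim
      case (elim n)
      show ?case
      proof
        fix k assume k: "k \<in> {..<NgS}"
        then have kN: "k < N" using NgS by simp
        then have s: "sn k < S" using less_NgS k by simp
        have "diffusion_run.mse P wstar w k n \<le> cS (sn k) * \<mu>"
          using elim s kN by (auto simp: subnet_def)
        also have "\<dots> \<le> c * \<mu>"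
          unfolding c_def using s cS0 \<mu> by (intro mult_right_mono member_le_sum[of "sn k" _ cS]) auto
        finally show "diffusion_run.mse P wstar w k n \<le> c * \<mu>" .
      qed
    qed
  qed
  let ?K = "{NgS..<N}"
  have block_R: "{l \<in> ?K. sn l = sn k} = ?I (sn k)" "S \<le> sn k" "sn k < S + R" if "k \<in> ?K" for k
  proof -
    show "S \<le> sn k" "sn k < S + R" using that less_NgS[of k] sn_range by auto
    then show "{l \<in> ?K. sn l = sn k} = ?I (sn k)"
      using less_NgS by (auto simp: subnet_def) (metis leI not_less)
  qed
  have grp: "receiving_group ?K a sn"
  proof
    show "(\<Sum>l\<in>?K. a l k) \<le> 1" if "k \<in> ?K" for k
    proof -
      have "(\<Sum>l\<in>?K. a l k) \<le> (\<Sum>l<N. a l k)" using that a_nonneg by (intro sum_mono2) auto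
      then show ?thesis using a_left_stoch that by auto
    qed
    show "irreducible_sub {l \<in> ?K. sn l = sn k} a" if "k \<in> ?K" for k
      using A_R_irred block_R[OF that] by simp
    show "\<exists>j\<in>?K. sn j = sn k \<and> (\<Sum>l | l \<in> ?K \<and> sn l = sn k. a l j) < 1" if k: "k \<in> ?K" for k
    proof -
      obtain j where j: "j \<in> ?I (sn k)" "(\<Sum>l\<in>?I (sn k). a l j) < 1"
        using A_R_deficient block_R[OF k] by blast
      then show ?thesis using block_R(1)[OF k] by (intro bexI[of _ j]) auto
    qed
  qed (use a_nonneg a_upper in auto)
  obtain h where h: "\<And>k. k \<in> ?K \<Longrightarrow> h k = 1 + (\<Sum>l\<in>?K. a l k * h l)" "\<And>k. k \<in> ?K \<Longrightarrow> 1 \<le> h k"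
    using receiving_weights[OF NgS grp] by blast
  \<comment> \<open>The transpose of W = T_SR + W T_RR, applied to the limit points of group
    \<open>S\<close>.\<close>
  have harmonic: "wstar k = (\<Sum>l<N. a l k *\<^sub>R wstar l)" if k: "k \<in> ?K" for k
  proof -
    let ?W = "\<lambda>l i. W_mat N NgS a $$ (l, i - NgS)"
    have "wstar k = (\<Sum>l<NgS. ?W l k *\<^sub>R wstar l)" using wstar_R k by simp
    also have "\<dots> = (\<Sum>l<NgS. a l k *\<^sub>R wstar l + (\<Sum>i\<in>?K. a i k *\<^sub>R (?W l i *\<^sub>R wstar l)))"
      using W_mat_eq[OF NgS grp _ k] by (intro sum.cong) (auto simp: scaleR_add_left scaleR_sum_left)
    also have "\<dots> = (\<Sum>l<NgS. a l k *\<^sub>R wstar l) + (\<Sum>i\<in>?K. a i k *\<^sub>R (\<Sum>l<NgS. ?W l i *\<^sub>R wstar l))"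
      unfolding sum.distrib scaleR_sum_right by (subst (2) sum.swap) simp
    also have "(\<Sum>i\<in>?K. a i k *\<^sub>R (\<Sum>l<NgS. ?W l i *\<^sub>R wstar l)) = (\<Sum>i\<in>?K. a i k *\<^sub>R wstar i)"
      using wstar_R by (intro sum.cong) auto
    also have "(\<Sum>l<NgS. a l k *\<^sub>R wstar l) + (\<Sum>i\<in>?K. a i k *\<^sub>R wstar i) = (\<Sum>l<N. a l k *\<^sub>R wstar l)"
      using NgS by (subst sum.union_disjoint[symmetric]) (auto intro!: sum.cong)
    finally show ?thesis .
  qed
  have "\<exists>\<mu>0>0. \<exists>c'\<ge>0. \<forall>\<mu>. 0 < \<mu> \<and> \<mu> < \<mu>0 \<longrightarrow>
    (\<forall>(P :: 'o measure) w x. diffusion_run P N a \<tau> \<beta> \<sigma> grad wstar \<mu> w x \<longrightarrow>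
      (\<forall>\<^sub>F n in sequentially. \<forall>k\<in>{..<N} - ?K. diffusion_run.mse P wstar w k n \<le> c * \<mu>) \<longrightarrow>
      (\<forall>\<^sub>F n in sequentially. \<forall>k\<in>?K. diffusion_run.mse P wstar w k n \<le> c' * \<mu>))"
    by (rule receiving_mean_square_bound[where h = h and L = L])
       (use a_nonneg a_left_stoch h harmonic tau lip c0 in auto)
  then obtain \<mu>R c' where \<mu>R: "0 < \<mu>R" and c': "0 \<le> c'"
    and group_R_bound: "\<forall>\<mu>. 0 < \<mu> \<and> \<mu> < \<mu>R \<longrightarrow>
    (\<forall>(P :: 'o measure) w x. diffusion_run P N a \<tau> \<beta> \<sigma> grad wstar \<mu> w x \<longrightarrow>
      (\<forall>\<^sub>F n in sequentially. \<forall>k\<in>{..<N} - ?K. diffusion_run.mse P wstar w k n \<le> c * \<mu>) \<longrightarrow>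
      (\<forall>\<^sub>F n in sequentially. \<forall>k\<in>?K. diffusion_run.mse P wstar w k n \<le> c' * \<mu>))"
    by (elim exE conjE)
  define \<mu>bar where "\<mu>bar = Min (insert \<mu>R (\<mu>S ` {..<S}))"
  have \<mu>bar: "0 < \<mu>bar"
  proof -
    have "\<forall>s\<in>{..<S}. 0 < \<mu>S s" using \<mu>S by blast
    then show ?thesis using \<mu>R by (simp add: \<mu>bar_def)
  qed
  have less_\<mu>bar: "\<mu> < \<mu>R" "\<And>s. s < S \<Longrightarrow> \<mu> < \<mu>S s" if "\<mu> < \<mu>bar" for \<mu>
    using that by (auto simp: \<mu>bar_def)
  have run_bound: "limsup (\<lambda>n. \<integral>\<^sup>+ y. ennreal ((norm (wstar k - w (Suc n) k y))\<^sup>2) \<partial>P) \<le> ennreal ((c + c') * \<mu>)"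
    if \<mu>: "0 < \<mu>" "\<mu> < \<mu>bar" and run: "diffusion_run P N a \<tau> \<beta> \<sigma> grad wstar \<mu> w x" and k: "k < N"
    for \<mu> and P :: "'o measure" and w x k
  proof -
    interpret diffusion_run P N a \<tau> \<beta> \<sigma> grad wstar \<mu> w x by fact
    have S_bound: "\<forall>\<^sub>F n in sequentially. \<forall>k\<in>{..<NgS}. mse k n \<le> c * \<mu>"
      using less_\<mu>bar[OF \<mu>(2)] by (intro group_S_bound[OF \<mu>(1) _ run])
    moreover have "{..<N} - ?K = {..<NgS}" using NgS by auto
    ultimately have "\<forall>\<^sub>F n in sequentially. \<forall>k\<in>{..<N} - ?K. mse k n \<le> c * \<mu>" by simp
    then have R_bound: "\<forall>\<^sub>F n in sequentially. \<forall>k\<in>?K. mse k n \<le> c' * \<mu>"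
      using group_R_bound \<mu>(1) less_\<mu>bar(1)[OF \<mu>(2)] run by blast
    have "\<forall>\<^sub>F n in sequentially. mse k n \<le> (c + c') * \<mu>"
      using S_bound R_bound
    proof eventually_elim
      case (elim n)
      have "0 \<le> c * \<mu>" "0 \<le> c' * \<mu>" using c0 c' \<mu> by auto
      moreover have "mse k n \<le> c * \<mu> \<or> mse k n \<le> c' * \<mu>" using elim k by (cases "k < NgS") auto
      ultimately show ?case by (auto simp: distrib_right)
    qed
    \<comment> \<open>In the shifted indexing \<open>w (Suc n) k\<close> is the iterate at time
      \<open>n\<close>.\<close>
    then have "\<forall>\<^sub>F n in sequentially. mse k (Suc n) \<le> (c + c') * \<mu>"
      by (subst eventually_sequentially_Suc)
    then have "\<forall>\<^sub>F n in sequentially.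
        (\<integral>\<^sup>+ y. ennreal ((norm (wstar k - w (Suc n) k y))\<^sup>2) \<partial>P) \<le> ennreal ((c + c') * \<mu>)"
    proof eventually_elim
      case (elim n)
      \<comment> \<open>Square integrability of the error makes the nonnegative integral finite and
        equal to \<open>mse\<close>.\<close>
      have "(\<integral>\<^sup>+ y. ennreal ((norm (wstar k - w (Suc n) k y))\<^sup>2) \<partial>P) = ennreal (mse k (Suc n))"
        unfolding mse_def using sq_int_integrable[OF sq_int_err[OF k, of "Suc n"]]
        by (subst nn_integral_eq_integral[symmetric]) (auto simp: err_def norm_minus_commute)
      then show ?case using elim by (simp add: ennreal_leI)
    qed
    then show ?thesis by (rule Limsup_bounded)
  qed
  show ?thesis
  proof (rule exI[of _ \<mu>bar], intro conjI \<mu>bar, rule exI[of _ "c + c'"], intro allI impI, goal_cases)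
    case (1 \<mu> P w x k)
    have "diffusion_run P N a \<tau> \<beta> \<sigma> grad wstar \<mu> w x"
    proof (intro diffusion_run.intro diffusion_run_axioms.intro)
      show "\<exists>L. \<forall>x y. norm (grad k x - grad k y) \<le> L * norm (x - y)" if "k < N" for k
        using lip[OF that] by blast
    qed (use 1 in simp_all)
    moreover have "0 < \<mu>" "\<mu> < \<mu>bar" "k < N" using 1 by simp_all
    ultimately show ?case by (intro run_bound[where P = P and w = w and x = x])
  qed
qed

end
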